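(* \textsc{Distinct OPT Kemeny Ranking Aggregation} admits a fixed-parameter algorithm in the combined parameter unanimity width $w$ and number of requested rankings $r$, which runs in time $O^*(2^{O(w)}\cdot r)$.
   Context: Let $\mathcal{C}$ be a set of candidates and $\Pi$ a multiset of rankings (complete linear orders) of $\mathcal{C}$. The unanimity order $\rho$ of $\Pi$ is the partial order containing $(a,b)$ iff every ranking in $\Pi$ prefers $a$ over $b$. Its co-comparability graph $G_\rho$ has vertex set $\mathcal{C}$ with an edge between $a$ and $b$ iff $a,b$ are incomparable in $\rho$ (i.e., not all rankings order them the same way). The unanimity width $w$ is the pathwidth of $G_\rho$. The Kendall-Tau distance $d_{KT}(\pi,\sigma)$ is the number of pairs of candidates that two rankings order differently. The Kemeny score of a ranking $Q$ is $\mathrm{Kemeny}_\Pi(Q)=\sum_{\pi\in\Pi} d_{KT}(Q,\pi)$; a Kemeny ranking minimizes it, and $K(\Pi)$ is the set of Kemeny rankings. \textsc{Distinct OPT Kemeny Ranking Aggregation}: given $(\mathcal{C},\Pi,r)$ with integer $r$, output $\min\{r,|K(\Pi)|\}$ distinct Kemeny rankings. $O^*(g)$ denotes $O(g\cdot \mathrm{poly}(\text{input size}))$. *)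

theory Defs
  imports
    "HOL-Combinatorics.Multiset_Permutations"
    "HOL-Computational_Algebra.Polynomial"
begin

section \<open>Rankings and Kemeny scores\<close>

text \<open>A ranking of a finite set \<open>C\<close> is a member of \<^term>\<open>permutations_of_set C\<close>: the list
  of all candidates, each once, most preferred first.\<close>

definition prefers :: "'a list \<Rightarrow> 'a \<Rightarrow> 'a \<Rightarrow> bool" where
  "prefers \<pi> a b \<longleftrightarrow> (\<exists>i j. i < j \<and> j < length \<pi> \<and> \<pi> ! i = a \<and> \<pi> ! j = b)"

text \<open>A pair of candidates ordered differently contributes exactly one ordered pair below,
  namely the one in the order of the first ranking.\<close>

definition kendall_tau :: "'a list \<Rightarrow> 'a list \<Rightarrow> nat" where
  "kendall_tau \<pi> \<sigma> = card {(a, b). prefers \<pi> a b \<and> prefers \<sigma> b a}"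

definition kemeny_score :: "'a list multiset \<Rightarrow> 'a list \<Rightarrow> nat" where
  "kemeny_score \<P> Q = (\<Sum>\<pi>\<in>#\<P>. kendall_tau Q \<pi>)"

definition kemeny_rankings :: "'a set \<Rightarrow> 'a list multiset \<Rightarrow> 'a list set" where
  "kemeny_rankings C \<P> =
     {Q \<in> permutations_of_set C.
        \<forall>Q' \<in> permutations_of_set C. kemeny_score \<P> Q \<le> kemeny_score \<P> Q'}"

section \<open>Unanimity width\<close>

definition unanimity_order :: "'a set \<Rightarrow> 'a list multiset \<Rightarrow> ('a \<times> 'a) set" where
  "unanimity_order C \<P> = {(a, b) \<in> C \<times> C. \<forall>\<pi>\<in>#\<P>. prefers \<pi> a b}"

definition cocomparability_edges :: "'a set \<Rightarrow> ('a \<times> 'a) set \<Rightarrow> 'a set set" where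
  "cocomparability_edges C \<rho> =
     {{a, b} | a b. a \<in> C \<and> b \<in> C \<and> a \<noteq> b \<and> (a, b) \<notin> \<rho> \<and> (b, a) \<notin> \<rho>}"

definition path_decomposition :: "'a set \<Rightarrow> 'a set set \<Rightarrow> 'a set list \<Rightarrow> bool" where
  "path_decomposition V E B \<longleftrightarrow>
     B \<noteq> [] \<and> \<Union>(set B) = V \<and> (\<forall>e\<in>E. \<exists>X\<in>set B. e \<subseteq> X) \<and>
     (\<forall>i j k. i \<le> j \<and> j \<le> k \<and> k < length B \<longrightarrow> B ! i \<inter> B ! k \<subseteq> B ! j)"

definition decomposition_width :: "'a set list \<Rightarrow> nat" where
  "decomposition_width B = Max (card ` set B) - 1"

text \<open>For the graph without vertices this gives 0.\<close>

definition pathwidth :: "'a set \<Rightarrow> 'a set set \<Rightarrow> nat" where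
  "pathwidth V E = (LEAST w. \<exists>B. path_decomposition V E B \<and> decomposition_width B = w)"

definition unanimity_width :: "'a set \<Rightarrow> 'a list multiset \<Rightarrow> nat" where
  "unanimity_width C \<P> = pathwidth C (cocomparability_edges C (unanimity_order C \<P>))"

section \<open>Model of computation\<close>

text \<open>
  Algorithms are programs of a first-order call-by-value language on binary trees (pure Lisp
  without higher-order functions, as in N. D. Jones, ``Computability and Complexity from a
  Programming Perspective''). A program is a list of function bodies, function \<open>0\<close> being the
  entry point; \<open>Var i\<close> is a de Bruijn index into the current environment, which consists of the
  values bound by \<open>LetE\<close>, innermost first, followed by the arguments of the enclosing call.

  Running time is the number of expression nodes evaluated. There are no arithmetic primitives and
  no equality test on trees: each step allocates or follows at most one pointer or pushes or pops
  one stack entry, so that a fixed program is simulated on a pointer machine or a unit-cost RAM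
  with a constant-factor overhead.
\<close>

datatype val = Atom | Pair val val

fun val_fst :: "val \<Rightarrow> val" where
  "val_fst Atom = Atom"
| "val_fst (Pair x y) = x"

fun val_snd :: "val \<Rightarrow> val" where
  "val_snd Atom = Atom"
| "val_snd (Pair x y) = y"

datatype exp =
    Var nat
  | AtomE
  | PairE exp exp
  | FstE exp
  | SndE exp
  | IfPair exp exp exp
  | LetE exp exp
  | Call nat "exp list"

type_synonym program = "exp list"

inductive eval :: "program \<Rightarrow> val list \<Rightarrow> exp \<Rightarrow> val \<Rightarrow> nat \<Rightarrow> bool"
  and evals :: "program \<Rightarrow> val list \<Rightarrow> exp list \<Rightarrow> val list \<Rightarrow> nat \<Rightarrow> bool"
  for P :: program where
  eval_Var: "i < length env \<Longrightarrow> eval P env (Var i) (env ! i) 1"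
| eval_Atom: "eval P env AtomE Atom 1"
| eval_Pair: "eval P env e1 v1 t1 \<Longrightarrow> eval P env e2 v2 t2 \<Longrightarrow>
    eval P env (PairE e1 e2) (Pair v1 v2) (t1 + t2 + 1)"
| eval_Fst: "eval P env e v t \<Longrightarrow> eval P env (FstE e) (val_fst v) (t + 1)"
| eval_Snd: "eval P env e v t \<Longrightarrow> eval P env (SndE e) (val_snd v) (t + 1)"
| eval_If_Pair: "eval P env e (Pair x y) t \<Longrightarrow> eval P env e1 v t1 \<Longrightarrow>
    eval P env (IfPair e e1 e2) v (t + t1 + 1)"
| eval_If_Atom: "eval P env e Atom t \<Longrightarrow> eval P env e2 v t2 \<Longrightarrow>
    eval P env (IfPair e e1 e2) v (t + t2 + 1)"
| eval_Let: "eval P env e1 v1 t1 \<Longrightarrow> eval P (v1 # env) e2 v2 t2 \<Longrightarrow>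
    eval P env (LetE e1 e2) v2 (t1 + t2 + 1)"
| eval_Call: "evals P env es vs t \<Longrightarrow> f < length P \<Longrightarrow> eval P vs (P ! f) v t' \<Longrightarrow>
    eval P env (Call f es) v (t + t' + 1)"
| evals_Nil: "evals P env [] [] 0"
| evals_Cons: "eval P env e v t \<Longrightarrow> evals P env es vs t' \<Longrightarrow>
    evals P env (e # es) (v # vs) (t + t')"

inductive_cases eval_VarE: "eval P env (Var i) v t"
inductive_cases eval_AtomE: "eval P env AtomE v t"
inductive_cases eval_PairE: "eval P env (PairE e1 e2) v t"
inductive_cases eval_FstE: "eval P env (FstE e) v t"
inductive_cases eval_SndE: "eval P env (SndE e) v t"
inductive_cases eval_IfE: "eval P env (IfPair e e1 e2) v t"
inductive_cases eval_LetE: "eval P env (LetE e1 e2) v t"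
inductive_cases eval_CallE: "eval P env (Call f es) v t"
inductive_cases evals_NilE: "evals P env [] vs t"
inductive_cases evals_ConsE: "evals P env (e # es) vs t"

lemma eval_deterministic:
  "eval P env e v t \<Longrightarrow> eval P env e v' t' \<Longrightarrow> v = v' \<and> t = t'"
  "evals P env es vs t \<Longrightarrow> evals P env es vs' t' \<Longrightarrow> vs = vs' \<and> t = t'"
proof (induction arbitrary: v' t' and vs' t' rule: eval_evals.inducts)
  case eval_Var
  then show ?case by (auto elim: eval_VarE)
next
  case eval_Atom
  then show ?case by (auto elim: eval_AtomE)
next
  case eval_Pair
  from eval_Pair.prems show ?case
    by (rule eval_PairE) (auto dest!: eval_Pair.IH(2,4))
next
  case eval_Fst
  from eval_Fst.prems show ?case
    by (rule eval_FstE) (auto dest!: eval_Fst.IH(2))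
next
  case eval_Snd
  from eval_Snd.prems show ?case
    by (rule eval_SndE) (auto dest!: eval_Snd.IH(2))
next
  case eval_If_Pair
  from eval_If_Pair.prems show ?case
    by (rule eval_IfE) (auto dest!: eval_If_Pair.IH(2,4))
next
  case eval_If_Atom
  from eval_If_Atom.prems show ?case
    by (rule eval_IfE) (auto dest!: eval_If_Atom.IH(2,4))
next
  case eval_Let
  from eval_Let.prems show ?case
    by (rule eval_LetE) (auto dest!: eval_Let.IH(2,4))
next
  case eval_Call
  from eval_Call.prems show ?case
    by (rule eval_CallE) (auto dest!: eval_Call.IH(2,5))
next
  case evals_Nil
  then show ?case by (auto elim: evals_NilE)
next
  case evals_Cons
  from evals_Cons.prems show ?case
    by (rule evals_ConsE) (auto dest!: evals_Cons.IH(2,4))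
qed

definition run :: "program \<Rightarrow> val \<Rightarrow> val \<Rightarrow> nat \<Rightarrow> bool" where
  "run P x y t \<longleftrightarrow> P \<noteq> [] \<and> eval P [x] (hd P) y t"

section \<open>Encoding of inputs and outputs\<close>

text \<open>Numbers are written in binary, least significant bit first, so that the input size is
  logarithmic in the number of requested rankings.\<close>

fun enc_nat :: "nat \<Rightarrow> val" where
  "enc_nat n =
     (if n = 0 then Atom
      else Pair (if odd n then Pair Atom Atom else Atom) (enc_nat (n div 2)))"

declare enc_nat.simps [simp del]

fun enc_list :: "('a \<Rightarrow> val) \<Rightarrow> 'a list \<Rightarrow> val" where
  "enc_list f [] = Atom"
| "enc_list f (x # xs) = Pair (f x) (enc_list f xs)"

definition enc_rankings :: "nat list list \<Rightarrow> val" where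
  "enc_rankings = enc_list (enc_list enc_nat)"

definition enc_instance :: "nat list \<Rightarrow> nat list list \<Rightarrow> nat \<Rightarrow> val" where
  "enc_instance cs \<pi>s r = Pair (enc_list enc_nat cs) (Pair (enc_rankings \<pi>s) (enc_nat r))"

fun input_size :: "val \<Rightarrow> nat" where
  "input_size Atom = 1"
| "input_size (Pair x y) = input_size x + input_size y + 1"

section \<open>The computational problem\<close>

definition distinct_opt_kemeny_solution ::
    "'a set \<Rightarrow> 'a list multiset \<Rightarrow> nat \<Rightarrow> 'a list list \<Rightarrow> bool" where
  "distinct_opt_kemeny_solution C \<P> r out \<longleftrightarrow>
     distinct out \<and> set out \<subseteq> kemeny_rankings C \<P> \<and>
     length out = min r (card (kemeny_rankings C \<P>))"

end

theory Submission
  imports Defs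
begin

text \<open>
  Rankings are built from the back. In a Kemeny ranking of a nonempty profile every candidate
  precedes all candidates that it unanimously beats, since exchanging two candidates in
  the wrong unanimous order strictly lowers the score; hence all suffixes are upsets of the
  unanimity order. Replacing a suffix by another one on the same set changes the score of the
  ranking exactly by the difference of their own scores, so it suffices to keep, for every upset of size \<open>k\<close>, at most \<open>r + 1\<close> suffixes of
  minimum score (one more than requested, so that no class becomes empty for \<open>r = 0\<close>).

  An upset is determined by its minimal elements, which form a clique of the co-comparability
  graph. A clique lies in the first bag of that one of its vertices which appears last in a path
  decomposition, so there are at most \<open>n 2\<^sup>w\<^sup>+\<^sup>1 + 1\<close> upsets. The decomposition itself is
  never computed.

  For the empty profile all rankings are optimal and the unanimity order is not a partial order.
  There the first ranking is read as the empty list (the first component of an atom is an atom), all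
  suffixes of the same length fall into a single class, and no extension is excluded.
\<close>

section \<open>Compositional evaluation of programs\<close>

text \<open>The delicate point is the cut-off: a minimum-score suffix may be absent from the next
  layer because its tail was dropped earlier, so a list cannot be claimed to hold all optimal
  suffixes of its class. What survives from layer to layer is the alternative "full or complete". An
  optimal tail is missing only from a list that already has \<open>r + 1\<close> members. Each of
  these can be prolonged to an optimal suffix of the class in question, and different tails give
  different suffixes, so the list that lacks the suffix is full as well.

  The language has neither arithmetic nor an equality test. Scores are kept in unary, which is
  affordable since they are at most cubic in the input size; the binary \<open>r\<close> is expanded
  to unary, at a cost absorbed by the factor \<open>r\<close> of the bound. A layer is a plain list
  of classes that is searched from the front, and every class of one layer is extended into the
  next, so the number of classes enters squared; hence the exponent \<open>2 * w\<close>.\<close>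

definition halts :: "program \<Rightarrow> nat \<Rightarrow> val list \<Rightarrow> bool" where
  "halts P f vs \<longleftrightarrow> f < length P \<and> (\<exists>v t. eval P vs (P ! f) v t)"

definition result :: "program \<Rightarrow> nat \<Rightarrow> val list \<Rightarrow> val" where
  "result P f vs = (THE v. \<exists>t. eval P vs (P ! f) v t)"

definition time :: "program \<Rightarrow> nat \<Rightarrow> val list \<Rightarrow> nat" where
  "time P f vs = (THE t. \<exists>v. eval P vs (P ! f) v t)"

lemma result_time_eq:
  assumes "eval P vs (P ! f) v t"
  shows "result P f vs = v" "time P f vs = t"
  unfolding result_def time_def using assms eval_deterministic(1)[OF assms] by blast+

lemma halts_eval:
  assumes "halts P f vs"
  shows "eval P vs (P ! f) (result P f vs) (time P f vs)"
  using assms result_time_eq unfolding halts_def by metis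

text \<open>Calls stay opaque: they refer to \<open>result\<close> instead of unfolding the callee.
  This keeps the recursion structural although programs are recursive, and lets facts about callees
  be supplied from outside.\<close>

fun sem :: "program \<Rightarrow> val list \<Rightarrow> exp \<Rightarrow> val" where
  "sem P env (Var i) = env ! i"
| "sem P env AtomE = Atom"
| "sem P env (PairE a b) = Pair (sem P env a) (sem P env b)"
| "sem P env (FstE a) = val_fst (sem P env a)"
| "sem P env (SndE a) = val_snd (sem P env a)"
| "sem P env (IfPair a b c) = (if sem P env a = Atom then sem P env c else sem P env b)"
| "sem P env (LetE a b) = sem P (sem P env a # env) b"
| "sem P env (Call f es) = result P f (map (sem P env) es)"

fun steps :: "program \<Rightarrow> val list \<Rightarrow> exp \<Rightarrow> nat" where
  "steps P env (Var i) = 1"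
| "steps P env AtomE = 1"
| "steps P env (PairE a b) = steps P env a + steps P env b + 1"
| "steps P env (FstE a) = steps P env a + 1"
| "steps P env (SndE a) = steps P env a + 1"
| "steps P env (IfPair a b c) =
     steps P env a + (if sem P env a = Atom then steps P env c else steps P env b) + 1"
| "steps P env (LetE a b) = steps P env a + steps P (sem P env a # env) b + 1"
| "steps P env (Call f es) =
     sum_list (map (steps P env) es) + time P f (map (sem P env) es) + 1"

text \<open>Only the branch that is taken has to be safe; the other one may contain a recursive call
  about which an induction hypothesis says nothing.\<close>

fun safe :: "program \<Rightarrow> val list \<Rightarrow> exp \<Rightarrow> bool" where
  "safe P env (Var i) \<longleftrightarrow> i < length env"
| "safe P env AtomE \<longleftrightarrow> True"
| "safe P env (PairE a b) \<longleftrightarrow> safe P env a \<and> safe P env b"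
| "safe P env (FstE a) \<longleftrightarrow> safe P env a"
| "safe P env (SndE a) \<longleftrightarrow> safe P env a"
| "safe P env (IfPair a b c) \<longleftrightarrow>
     safe P env a \<and> (if sem P env a = Atom then safe P env c else safe P env b)"
| "safe P env (LetE a b) \<longleftrightarrow> safe P env a \<and> safe P (sem P env a # env) b"
| "safe P env (Call f es) \<longleftrightarrow> (\<forall>e\<in>set es. safe P env e) \<and> halts P f (map (sem P env) es)"

lemma evals_map:
  assumes "\<And>e. e \<in> set es \<Longrightarrow> eval P env e (v e) (t e)"
  shows "evals P env es (map v es) (sum_list (map t es))"
  using assms by (induction es) (auto intro: eval_evals.intros)

lemma safe_eval: "safe P env e \<Longrightarrow> eval P env e (sem P env e) (steps P env e)"
proof (induction e arbitrary: env)
  case (IfPair a b c)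
  show ?case
  proof (cases "sem P env a")
    case Atom
    then show ?thesis using IfPair.IH(1)[of env] IfPair.IH(3)[of env] IfPair.prems
      by (auto intro: eval_If_Atom[simplified])
  next
    case (Pair x y)
    then show ?thesis using IfPair.IH(1)[of env] IfPair.IH(2)[of env] IfPair.prems
      by (auto intro: eval_If_Pair[simplified])
  qed
next
  case (Call f es)
  then have "evals P env es (map (sem P env) es) (sum_list (map (steps P env) es))"
    by (intro evals_map) auto
  moreover have h: "halts P f (map (sem P env) es)" using Call.prems by simp
  ultimately show ?case using halts_eval[OF h] h
    by (auto intro: eval_Call[simplified] simp: halts_def)
qed (auto intro: eval_evals.intros[simplified])

definition computes :: "program \<Rightarrow> nat \<Rightarrow> val list \<Rightarrow> val \<Rightarrow> nat \<Rightarrow> bool" where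
  "computes P f vs v T \<longleftrightarrow> halts P f vs \<and> result P f vs = v \<and> time P f vs \<le> T"

text \<open>Reduces a claim about a function to symbolic evaluation of its body by the simplifier.
  The calls in the body are rewritten by facts obtained through \<open>computesD\<close>, recursive
  ones by the induction hypothesis.\<close>

lemma computesI:
  assumes "f < length P" "safe P vs (P ! f)" "sem P vs (P ! f) = v" "steps P vs (P ! f) \<le> T"
  shows "computes P f vs v T"
  using safe_eval[OF assms(2)] assms result_time_eq unfolding computes_def halts_def by metis

lemma computesD:
  assumes "computes P f vs v T"
  shows "halts P f vs" "result P f vs = v" "time P f vs \<le> T"
  using assms unfolding computes_def by auto

lemma computes_mono: "computes P f vs v T \<Longrightarrow> T \<le> T' \<Longrightarrow> computes P f vs v T'"
  unfolding computes_def by auto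

section \<open>The program\<close>

abbreviation "TrueE \<equiv> PairE AtomE AtomE"

abbreviation "eqE a b \<equiv> Call 1 [a, b]"
abbreviation "memberE x l \<equiv> Call 2 [x, l]"
abbreviation "prefersE p a b \<equiv> Call 3 [p, a, b]"
abbreviation "some_prefersE ps a b \<equiv> Call 4 [ps, a, b]"
abbreviation "admissibleE D ps c q \<equiv> Call 5 [D, ps, c, q]"
abbreviation "supportE ps d c acc \<equiv> Call 6 [ps, d, c, acc]"
abbreviation "supportsE q ps c acc \<equiv> Call 7 [q, ps, c, acc]"
abbreviation "scoreE q ps \<equiv> Call 8 [q, ps]"
abbreviation "leqE m n \<equiv> Call 9 [m, n]"
abbreviation "sameE D p q \<equiv> Call 10 [D, p, q]"
abbreviation "takeE n l \<equiv> Call 11 [n, l]"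
abbreviation "appendE l l' \<equiv> Call 12 [l, l']"
abbreviation "combineE s b ps R \<equiv> Call 13 [s, b, ps, R]"
abbreviation "insertE L b ps R \<equiv> Call 14 [L, b, ps, R]"
abbreviation "extendE s c ps \<equiv> Call 15 [s, c, ps]"
abbreviation "extend_allE cs s acc ps R \<equiv> Call 16 [cs, s, acc, ps, R]"
abbreviation "next_layerE L acc cs ps R \<equiv> Call 17 [L, acc, cs, ps, R]"
abbreviation "iterateE xs L cs ps R \<equiv> Call 18 [xs, L, cs, ps, R]"
abbreviation "unaryE b \<equiv> Call 19 [b]"

text \<open>\<open>PairE TrueE AtomE\<close> is the code of the initial layer \<open>[[[]]]\<close>,
  and \<open>PairE AtomE (Var 0)\<close> is the unary \<open>r + 1\<close>. The candidate list is
  passed twice: once as loop counter, once as the supply of candidates to put in front.\<close>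

definition main_body :: exp where
  "main_body =
     LetE (unaryE (SndE (SndE (Var 0))))
     (takeE (Var 0)
       (FstE (iterateE (FstE (Var 1)) (PairE TrueE AtomE) (FstE (Var 1)) (FstE (SndE (Var 1)))
         (PairE AtomE (Var 0)))))"

definition eq_body :: exp where
  "eq_body =
     IfPair (Var 0)
     (IfPair (Var 1)
       (IfPair (eqE (FstE (Var 0)) (FstE (Var 1))) (eqE (SndE (Var 0)) (SndE (Var 1))) AtomE)
       AtomE)
     (IfPair (Var 1) AtomE TrueE)"

definition member_body :: exp where
  "member_body =
     IfPair (Var 1)
     (IfPair (eqE (Var 0) (FstE (Var 1))) TrueE (memberE (Var 0) (SndE (Var 1)))) AtomE"

definition prefers_body :: exp where
  "prefers_body =
     IfPair (Var 0)
     (IfPair (eqE (Var 1) (FstE (Var 0)))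
       (memberE (Var 2) (SndE (Var 0)))
       (prefersE (SndE (Var 0)) (Var 1) (Var 2)))
     AtomE"

definition some_prefers_body :: exp where
  "some_prefers_body =
     IfPair (Var 0)
     (IfPair (prefersE (FstE (Var 0)) (Var 1) (Var 2))
       TrueE
       (some_prefersE (SndE (Var 0)) (Var 1) (Var 2)))
     AtomE"

definition admissible_body :: exp where
  "admissible_body =
     IfPair (Var 0)
     (IfPair (memberE (FstE (Var 0)) (Var 3))
       (admissibleE (SndE (Var 0)) (Var 1) (Var 2) (Var 3))
       (IfPair (some_prefersE (Var 1) (FstE (Var 0)) (Var 2))
         (admissibleE (SndE (Var 0)) (Var 1) (Var 2) (Var 3))
         AtomE))
     TrueE"

definition support_body :: exp where
  "support_body =
     IfPair (Var 0)
     (supportE (SndE (Var 0)) (Var 1) (Var 2)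
       (IfPair (prefersE (FstE (Var 0)) (Var 1) (Var 2)) (PairE AtomE (Var 3)) (Var 3)))
     (Var 3)"

definition supports_body :: exp where
  "supports_body =
     IfPair (Var 0)
     (supportsE (SndE (Var 0)) (Var 1) (Var 2) (supportE (Var 1) (FstE (Var 0)) (Var 2) (Var 3)))
     (Var 3)"

definition score_body :: exp where
  "score_body =
     IfPair (Var 0)
     (supportsE (SndE (Var 0)) (Var 1) (FstE (Var 0)) (scoreE (SndE (Var 0)) (Var 1)))
     AtomE"

definition leq_body :: exp where
  "leq_body =
     IfPair (Var 0) (IfPair (Var 1) (leqE (SndE (Var 0)) (SndE (Var 1))) AtomE) TrueE"

definition same_body :: exp where
  "same_body =
     IfPair (Var 0)
     (IfPair (memberE (FstE (Var 0)) (Var 1))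
       (IfPair (memberE (FstE (Var 0)) (Var 2)) (sameE (SndE (Var 0)) (Var 1) (Var 2)) AtomE)
       (IfPair (memberE (FstE (Var 0)) (Var 2)) AtomE (sameE (SndE (Var 0)) (Var 1) (Var 2))))
     TrueE"

definition take_body :: exp where
  "take_body =
     IfPair (Var 0)
     (IfPair (Var 1) (PairE (FstE (Var 1)) (takeE (SndE (Var 0)) (SndE (Var 1)))) AtomE)
     AtomE"

definition append_body :: exp where
  "append_body =
     IfPair (Var 0) (PairE (FstE (Var 0)) (appendE (SndE (Var 0)) (Var 1))) (Var 1)"

definition combine_body :: exp where
  "combine_body =
     IfPair (leqE (scoreE (FstE (Var 0)) (Var 2)) (scoreE (FstE (Var 1)) (Var 2)))
     (IfPair (leqE (scoreE (FstE (Var 1)) (Var 2)) (scoreE (FstE (Var 0)) (Var 2)))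
       (takeE (Var 3) (appendE (Var 0) (Var 1)))
       (Var 0))
     (Var 1)"

definition insert_body :: exp where
  "insert_body =
     IfPair (Var 0)
     (IfPair (sameE (FstE (Var 2)) (FstE (FstE (Var 0))) (FstE (Var 1)))
       (PairE (combineE (FstE (Var 0)) (Var 1) (Var 2) (Var 3)) (SndE (Var 0)))
       (PairE (FstE (Var 0)) (insertE (SndE (Var 0)) (Var 1) (Var 2) (Var 3))))
     (PairE (Var 1) AtomE)"

definition extend_body :: exp where
  "extend_body =
     IfPair (Var 0)
     (IfPair (memberE (Var 1) (FstE (Var 0)))
       (extendE (SndE (Var 0)) (Var 1) (Var 2))
       (IfPair (admissibleE (FstE (Var 2)) (Var 2) (Var 1) (PairE (Var 1) (FstE (Var 0))))
         (PairE (PairE (Var 1) (FstE (Var 0))) (extendE (SndE (Var 0)) (Var 1) (Var 2)))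
         (extendE (SndE (Var 0)) (Var 1) (Var 2))))
     AtomE"

definition extend_all_body :: exp where
  "extend_all_body =
     IfPair (Var 0)
     (extend_allE (SndE (Var 0)) (Var 1)
       (LetE (extendE (Var 1) (FstE (Var 0)) (Var 3))
         (IfPair (Var 0) (insertE (Var 3) (Var 0) (Var 4) (Var 5)) (Var 3)))
       (Var 3) (Var 4))
     (Var 2)"

definition next_layer_body :: exp where
  "next_layer_body =
     IfPair (Var 0)
     (next_layerE (SndE (Var 0)) (extend_allE (Var 2) (FstE (Var 0)) (Var 1) (Var 3) (Var 4))
       (Var 2) (Var 3) (Var 4))
     (Var 1)"

definition iterate_body :: exp where
  "iterate_body =
     IfPair (Var 0)
     (iterateE (SndE (Var 0)) (next_layerE (Var 1) AtomE (Var 2) (Var 3) (Var 4))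
       (Var 2) (Var 3) (Var 4))
     (Var 1)"

definition unary_body :: exp where
  "unary_body =
     IfPair (Var 0)
     (LetE (unaryE (SndE (Var 0)))
       (appendE (Var 0) (appendE (Var 0) (IfPair (FstE (Var 1)) TrueE AtomE))))
     AtomE"

definition kemeny_prog :: program where
  "kemeny_prog =
     [main_body, eq_body, member_body, prefers_body, some_prefers_body, admissible_body,
      support_body, supports_body, score_body, leq_body, same_body, take_body, append_body,
      combine_body, insert_body, extend_body, extend_all_body, next_layer_body,
      iterate_body, unary_body]"

lemma length_kemeny_prog [simp]: "length kemeny_prog = 20"
  by (simp add: kemeny_prog_def)

lemma kemeny_prog_nth [simp]:
  "kemeny_prog ! 0 = main_body"
  "kemeny_prog ! Suc 0 = eq_body"
  "kemeny_prog ! 2 = member_body"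
  "kemeny_prog ! 3 = prefers_body"
  "kemeny_prog ! 4 = some_prefers_body"
  "kemeny_prog ! 5 = admissible_body"
  "kemeny_prog ! 6 = support_body"
  "kemeny_prog ! 7 = supports_body"
  "kemeny_prog ! 8 = score_body"
  "kemeny_prog ! 9 = leq_body"
  "kemeny_prog ! 10 = same_body"
  "kemeny_prog ! 11 = take_body"
  "kemeny_prog ! 12 = append_body"
  "kemeny_prog ! 13 = combine_body"
  "kemeny_prog ! 14 = insert_body"
  "kemeny_prog ! 15 = extend_body"
  "kemeny_prog ! 16 = extend_all_body"
  "kemeny_prog ! 17 = next_layer_body"
  "kemeny_prog ! 18 = iterate_body"
  "kemeny_prog ! 19 = unary_body"
  by (simp_all add: kemeny_prog_def)

abbreviation "prog_computes \<equiv> computes kemeny_prog"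

definition enc_bool :: "bool \<Rightarrow> val" where
  "enc_bool b = (if b then Pair Atom Atom else Atom)"

lemma enc_bool_simps [simp]:
  "enc_bool b = Atom \<longleftrightarrow> \<not> b" "enc_bool True = Pair Atom Atom" "enc_bool False = Atom"
  by (auto simp: enc_bool_def)

primrec enc_unary :: "nat \<Rightarrow> val" where
  "enc_unary 0 = Atom"
| "enc_unary (Suc n) = Pair Atom (enc_unary n)"

lemma enc_unary_Atom [simp]: "enc_unary n = Atom \<longleftrightarrow> n = 0"
  by (cases n) auto

lemma enc_list_Atom [simp]: "enc_list f l = Atom \<longleftrightarrow> l = []"
  by (cases l) auto

text \<open>The bound mentions only the first tree because the comparison stops as soon as either
  tree ends. Searching a list for \<open>x\<close> can thus be bounded by the size of
  \<open>x\<close> and the length of the list.\<close>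

lemma compute_eq: "prog_computes 1 [a, b] (enc_bool (a = b)) (20 * input_size a)"
proof (induction a arbitrary: b)
  case Atom
  show ?case by (rule computesI) (cases b, auto simp: eq_body_def)
next
  case (Pair x y)
  show ?case
  proof (cases b)
    case Atom
    then show ?thesis by (intro computesI) (auto simp: eq_body_def)
  next
    case [simp]: (Pair x' y')
    note IH = computesD[OF Pair.IH(1)[of x']] computesD[OF Pair.IH(2)[of y']]
    show ?thesis using IH by (intro computesI) (auto simp: eq_body_def)
  qed
qed

section \<open>The dynamic program\<close>

definition support :: "'a list list \<Rightarrow> 'a \<Rightarrow> 'a \<Rightarrow> nat" where
  "support \<pi>s a b = length (filter (\<lambda>\<pi>. prefers \<pi> a b) \<pi>s)"

text \<open>The Kemeny score restricted to the pairs inside a suffix: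
  \<open>support \<pi>s d c\<close> counts the rankings that object to \<open>c\<close> standing
  before \<open>d\<close>.\<close>

primrec score :: "'a list list \<Rightarrow> 'a list \<Rightarrow> nat" where
  "score \<pi>s [] = 0"
| "score \<pi>s (c # q) = (\<Sum>d\<leftarrow>q. support \<pi>s d c) + score \<pi>s q"

definition first_ranking :: "'a list list \<Rightarrow> 'a list" where
  "first_ranking \<pi>s = (case \<pi>s of [] \<Rightarrow> [] | \<pi> # _ \<Rightarrow> \<pi>)"

text \<open>For complete rankings a dissenting ranking is the negation of \<open>c\<close> beating
  \<open>d\<close> unanimously. The condition thus says that \<open>c\<close> beats no candidate
  left outside, which keeps the suffix an upset.\<close>

definition admissible :: "'a list list \<Rightarrow> 'a \<Rightarrow> 'a list \<Rightarrow> bool" where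
  "admissible \<pi>s c q \<longleftrightarrow>
     (\<forall>d\<in>set (first_ranking \<pi>s). d \<in> set (c # q) \<or> (\<exists>\<pi>\<in>set \<pi>s. prefers \<pi> d c))"

definition key :: "'a list list \<Rightarrow> 'a list \<Rightarrow> 'a set" where
  "key \<pi>s q = set q \<inter> set (first_ranking \<pi>s)"

text \<open>Comparing heads suffices because all members of one list will have the same
  score.\<close>

definition combine :: "'a list list \<Rightarrow> nat \<Rightarrow> 'a list list \<Rightarrow> 'a list list \<Rightarrow> 'a list list" where
  "combine \<pi>s R s b =
     (if score \<pi>s (hd s) \<le> score \<pi>s (hd b)
      then if score \<pi>s (hd b) \<le> score \<pi>s (hd s) then take R (s @ b) else s
      else b)"

fun insert_state ::
    "'a list list \<Rightarrow> nat \<Rightarrow> 'a list list list \<Rightarrow> 'a list list \<Rightarrow> 'a list list list" where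
  "insert_state \<pi>s R [] b = [b]"
| "insert_state \<pi>s R (s # L) b =
     (if key \<pi>s (hd s) = key \<pi>s (hd b) then combine \<pi>s R s b # L
      else s # insert_state \<pi>s R L b)"

text \<open>An empty list must not become a state: key and score of a state are read off its
  head.\<close>

definition add_state ::
    "'a list list \<Rightarrow> nat \<Rightarrow> 'a list list list \<Rightarrow> 'a list list \<Rightarrow> 'a list list list" where
  "add_state \<pi>s R L b = (if b = [] then L else insert_state \<pi>s R L b)"

definition extend :: "'a list list \<Rightarrow> 'a list list \<Rightarrow> 'a \<Rightarrow> 'a list list" where
  "extend \<pi>s s c = map ((#) c) (filter (\<lambda>q. c \<notin> set q \<and> admissible \<pi>s c q) s)"

definition extend_all ::
    "'a list list \<Rightarrow> nat \<Rightarrow> 'a list \<Rightarrow> 'a list list \<Rightarrow> 'a list list list \<Rightarrow> 'a list list list" where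
  "extend_all \<pi>s R cs s L = foldl (\<lambda>L c. add_state \<pi>s R L (extend \<pi>s s c)) L cs"

definition next_layer ::
    "'a list list \<Rightarrow> nat \<Rightarrow> 'a list \<Rightarrow> 'a list list list \<Rightarrow> 'a list list list \<Rightarrow> 'a list list list" where
  "next_layer \<pi>s R cs L L' = foldl (\<lambda>L' s. extend_all \<pi>s R cs s L') L' L"

primrec layer :: "'a list list \<Rightarrow> nat \<Rightarrow> 'a list \<Rightarrow> nat \<Rightarrow> 'a list list list" where
  "layer \<pi>s R cs 0 = [[[]]]"
| "layer \<pi>s R cs (Suc k) = next_layer \<pi>s R cs (layer \<pi>s R cs k) []"

text \<open>The suffixes that would be enumerated if nothing were ever cut off or discarded; the
  reference against which the actual layers are measured.\<close>

fun valid :: "'a list list \<Rightarrow> 'a list \<Rightarrow> 'a list \<Rightarrow> bool" where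
  "valid \<pi>s cs [] \<longleftrightarrow> True"
| "valid \<pi>s cs (c # q) \<longleftrightarrow> valid \<pi>s cs q \<and> c \<in> set cs \<and> c \<notin> set q \<and> admissible \<pi>s c q"

lemma valid_subset: "valid \<pi>s cs q \<Longrightarrow> set q \<subseteq> set cs"
  by (induction q) auto

lemma valid_distinct: "valid \<pi>s cs q \<Longrightarrow> distinct q"
  by (induction q) auto

lemma valid_length:
  assumes "valid \<pi>s cs q"
  shows "length q \<le> length cs"
  using valid_subset[OF assms] valid_distinct[OF assms]
  by (metis card_length card_mono distinct_card finite_set le_trans)

lemma prefers_Cons: "prefers (x # \<pi>) a b \<longleftrightarrow> (x = a \<and> b \<in> set \<pi>) \<or> prefers \<pi> a b"
proof
  assume "prefers (x # \<pi>) a b"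
  then obtain i j where ij: "i < j" "j < Suc (length \<pi>)" "(x # \<pi>) ! i = a" "(x # \<pi>) ! j = b"
    unfolding prefers_def by auto
  then obtain j' where "j = Suc j'" by (cases j) auto
  with ij show "(x = a \<and> b \<in> set \<pi>) \<or> prefers \<pi> a b"
    by (cases i) (auto simp: prefers_def)
next
  assume "(x = a \<and> b \<in> set \<pi>) \<or> prefers \<pi> a b"
  then show "prefers (x # \<pi>) a b"
  proof
    assume "x = a \<and> b \<in> set \<pi>"
    then obtain j where "j < length \<pi>" "\<pi> ! j = b" "x = a" by (auto simp: in_set_conv_nth)
    then show ?thesis unfolding prefers_def
      by (intro exI[of _ 0] exI[of _ "Suc j"]) auto
  next
    assume "prefers \<pi> a b"
    then obtain i j where "i < j" "j < length \<pi>" "\<pi> ! i = a" "\<pi> ! j = b"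
      unfolding prefers_def by auto
    then show ?thesis unfolding prefers_def
      by (intro exI[of _ "Suc i"] exI[of _ "Suc j"]) auto
  qed
qed

lemma prefers_Nil [simp]: "\<not> prefers [] a b"
  by (simp add: prefers_def)

lemma prefers_in_set: "prefers \<pi> a b \<Longrightarrow> a \<in> set \<pi> \<and> b \<in> set \<pi>"
  by (auto simp: prefers_def)

lemma support_le: "support \<pi>s a b \<le> length \<pi>s"
  by (simp add: support_def)

text \<open>Scores being unary, this is what bounds the time for comparing two of them, and the
  origin of the cubic term in \<open>t_leq\<close>.\<close>

lemma score_le: "score \<pi>s q \<le> length q * length q * length \<pi>s"
proof (induction q)
  case (Cons c q)
  have "(\<Sum>d\<leftarrow>q. support \<pi>s d c) \<le> (\<Sum>d\<leftarrow>q. length \<pi>s)"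
    by (rule sum_list_mono) (rule support_le)
  then show ?case using Cons by (auto simp: sum_list_triv algebra_simps)
qed simp

section \<open>Running time\<close>

text \<open>The program sees candidates only through their codes, so equality of trees has to
  coincide with equality of candidates.\<close>

lemma enc_nat_inject [simp]: "enc_nat m = enc_nat n \<longleftrightarrow> m = n"
proof
  show "enc_nat m = enc_nat n \<Longrightarrow> m = n"
  proof (induction m arbitrary: n rule: less_induct)
    case (less m)
    then have eq: "(m = 0) = (n = 0)" by (auto simp: enc_nat.simps[of m] enc_nat.simps[of n] split: if_splits)
    show ?case
    proof (cases "m = 0")
      case False
      with less.prems eq have "odd m = odd n" "enc_nat (m div 2) = enc_nat (n div 2)"
        by (auto simp: enc_nat.simps[of m] enc_nat.simps[of n] split: if_splits)
      moreover from this False have "m div 2 = n div 2" by (intro less.IH) auto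
      ultimately show ?thesis by (metis odd_two_times_div_two_succ even_two_times_div_two)
    qed (use eq in simp)
  qed
qed simp

abbreviation "enc_nats \<equiv> enc_list enc_nat"
abbreviation "enc_layer \<equiv> enc_list enc_rankings"

lemma val_fst_enc_rankings [simp]: "l \<noteq> [] \<Longrightarrow> val_fst (enc_rankings l) = enc_nats (hd l)"
  by (cases l) (auto simp: enc_rankings_def)

lemma val_fst_enc_profile: "val_fst (enc_rankings \<pi>s) = enc_nats (first_ranking \<pi>s)"
  by (cases \<pi>s) (auto simp: enc_rankings_def first_ranking_def)

lemma enc_rankings_simps [simp]:
  "enc_rankings [] = Atom" "enc_rankings (q # qs) = Pair (enc_nats q) (enc_rankings qs)"
  "enc_rankings l = Atom \<longleftrightarrow> l = []"
  by (auto simp: enc_rankings_def)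

text \<open>Everything is bounded in one parameter \<open>Z\<close>, later the input size. A factor
  \<open>Suc Z\<close> counts the rounds of a list recursion; the additive constants are generous
  estimates for one function body.\<close>

definition t_member :: "nat \<Rightarrow> nat" where "t_member Z = (20 * Z + 20) * Suc Z"
definition t_prefers :: "nat \<Rightarrow> nat" where "t_prefers Z = 2 * t_member Z"
definition t_support :: "nat \<Rightarrow> nat" where "t_support Z = (t_prefers Z + 20) * Suc Z"
definition t_admissible :: "nat \<Rightarrow> nat" where
  "t_admissible Z = (t_member Z + t_support Z + 20) * Suc Z"
definition t_supports :: "nat \<Rightarrow> nat" where "t_supports Z = (t_support Z + 20) * Suc Z"
definition t_score :: "nat \<Rightarrow> nat" where "t_score Z = (t_supports Z + 20) * Suc Z"
definition t_leq :: "nat \<Rightarrow> nat" where "t_leq Z = 20 * Suc (Z * Z * Z)"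
definition t_same :: "nat \<Rightarrow> nat" where "t_same Z = (2 * t_member Z + 20) * Suc Z"
definition t_combine :: "nat \<Rightarrow> nat" where "t_combine Z = 4 * t_score Z + 2 * t_leq Z + 140"

definition small :: "nat \<Rightarrow> nat list \<Rightarrow> bool" where
  "small Z l \<longleftrightarrow> length l \<le> Z \<and> (\<forall>x\<in>set l. input_size (enc_nat x) \<le> Z)"

lemma small_Cons: "small Z (x # l) \<Longrightarrow> input_size (enc_nat x) \<le> Z \<and> small Z l"
  by (auto simp: small_def)

lemma compute_member_aux:
  assumes "input_size (enc_nat x) \<le> Z"
  shows "prog_computes 2 [enc_nat x, enc_nats l] (enc_bool (x \<in> set l)) ((20 * Z + 20) * Suc (length l))"
proof (induction l)
  case Nil
  show ?case by (rule computesI) (auto simp: member_body_def)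
next
  case (Cons y l)
  note computesD[OF compute_eq[of "enc_nat x" "enc_nat y"]] computesD[OF Cons.IH] assms
  then show ?case by (intro computesI) (auto simp: member_body_def)
qed

lemma compute_member:
  assumes "input_size (enc_nat x) \<le> Z" "length l \<le> Z"
  shows "prog_computes 2 [enc_nat x, enc_nats l] (enc_bool (x \<in> set l)) (t_member Z)"
  by (rule computes_mono[OF compute_member_aux[OF assms(1)]])
     (use assms in \<open>auto simp: t_member_def intro!: mult_le_mono\<close>)

lemma compute_prefers_aux:
  assumes "input_size (enc_nat a) \<le> Z" "input_size (enc_nat b) \<le> Z" "length \<pi> \<le> Z"
  shows "prog_computes 3 [enc_nats \<pi>, enc_nat a, enc_nat b] (enc_bool (prefers \<pi> a b))
           ((20 * Z + 20) * Suc (length \<pi>) + t_member Z)"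
  using assms(3)
proof (induction \<pi>)
  case Nil
  show ?case by (rule computesI) (auto simp: prefers_body_def)
next
  case (Cons x \<pi>)
  then have "length \<pi> \<le> Z" by simp
  note facts = computesD[OF compute_eq[of "enc_nat a" "enc_nat x"]] computesD[OF Cons.IH[OF this]]
    computesD[OF compute_member[OF assms(2) this]] assms
  \<comment> \<open>Stopping at the first occurrence of \<open>a\<close> loses nothing: a
    \<open>b\<close> behind a later occurrence is also behind the first one.\<close>
  have eq: "prefers (x # \<pi>) a b \<longleftrightarrow> (if a = x then b \<in> set \<pi> else prefers \<pi> a b)"
    by (auto simp: prefers_Cons dest: prefers_in_set)
  from facts show ?case unfolding eq by (intro computesI) (auto simp: prefers_body_def)
qed

lemma compute_prefers:
  assumes "input_size (enc_nat a) \<le> Z" "input_size (enc_nat b) \<le> Z" "length \<pi> \<le> Z"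
  shows "prog_computes 3 [enc_nats \<pi>, enc_nat a, enc_nat b] (enc_bool (prefers \<pi> a b)) (t_prefers Z)"
proof -
  have "(20 * Z + 20) * Suc (length \<pi>) \<le> t_member Z"
    unfolding t_member_def using assms by (intro mult_le_mono) auto
  then show ?thesis
    by (intro computes_mono[OF compute_prefers_aux[OF assms]]) (auto simp: t_prefers_def)
qed

lemma compute_some_prefers_aux:
  assumes "input_size (enc_nat a) \<le> Z" "input_size (enc_nat b) \<le> Z" "\<forall>\<pi>\<in>set \<pi>s. length \<pi> \<le> Z"
  shows "prog_computes 4 [enc_rankings \<pi>s, enc_nat a, enc_nat b]
           (enc_bool (\<exists>\<pi>\<in>set \<pi>s. prefers \<pi> a b)) ((t_prefers Z + 20) * Suc (length \<pi>s))"
  using assms(3)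
proof (induction \<pi>s)
  case Nil
  show ?case by (rule computesI) (auto simp: some_prefers_body_def)
next
  case (Cons \<pi> \<pi>s)
  then have "length \<pi> \<le> Z" "\<forall>\<pi>\<in>set \<pi>s. length \<pi> \<le> Z" by auto
  note facts = computesD[OF Cons.IH[OF this(2)]]
    computesD[OF compute_prefers[OF assms(1,2) this(1)]]
  from facts show ?case by (intro computesI) (auto simp: some_prefers_body_def)
qed

lemma compute_support_aux:
  assumes "input_size (enc_nat a) \<le> Z" "input_size (enc_nat b) \<le> Z" "\<forall>\<pi>\<in>set \<pi>s. length \<pi> \<le> Z"
  shows "prog_computes 6 [enc_rankings \<pi>s, enc_nat a, enc_nat b, enc_unary n]
           (enc_unary (support \<pi>s a b + n)) ((t_prefers Z + 20) * Suc (length \<pi>s))"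
  using assms(3)
proof (induction \<pi>s arbitrary: n)
  case Nil
  show ?case by (rule computesI) (auto simp: support_body_def support_def)
next
  case (Cons \<pi> \<pi>s)
  then have "length \<pi> \<le> Z" "\<forall>\<pi>\<in>set \<pi>s. length \<pi> \<le> Z" by auto
  \<comment> \<open>Two instances of the induction hypothesis, since the accumulator passed on is
    \<open>n\<close> or \<open>Suc n\<close> depending on the ranking just read.\<close>
  note facts = computesD[OF Cons.IH[OF this(2), of n]] computesD[OF Cons.IH[OF this(2), of "Suc n"]]
    computesD[OF compute_prefers[OF assms(1,2) this(1)]]
  from facts show ?case by (intro computesI) (auto simp: support_body_def support_def)
qed

lemma compute_leq:
  "prog_computes 9 [enc_unary m, enc_unary n] (enc_bool (m \<le> n)) (20 * Suc m)"
proof (induction m arbitrary: n)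
  case 0
  show ?case by (rule computesI) (auto simp: leq_body_def)
next
  case (Suc m)
  note facts = computesD[OF Suc.IH[of "n - 1"]]
  from facts show ?case by (intro computesI; cases n) (auto simp: leq_body_def)
qed

lemma compute_take:
  "prog_computes 11 [enc_unary n, enc_list f l] (enc_list f (take n l)) (20 * Suc n)"
proof (induction n arbitrary: l)
  case 0
  show ?case by (rule computesI) (auto simp: take_body_def)
next
  case (Suc n)
  note facts = computesD[OF Suc.IH[of "tl l"]]
  from facts show ?case by (intro computesI; cases l) (auto simp: take_body_def)
qed

lemma compute_append:
  "prog_computes 12 [enc_list f l, enc_list f l'] (enc_list f (l @ l')) (20 * Suc (length l))"
proof (induction l)
  case Nil
  show ?case by (rule computesI) (auto simp: append_body_def)
next
  case (Cons x l)
  note facts = computesD[OF Cons.IH]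
  from facts show ?case by (intro computesI) (auto simp: append_body_def)
qed

section \<open>Admissibility, scores, keys and merging for a fixed small profile\<close>

context
  fixes Z :: nat and \<pi>s :: "nat list list"
  assumes profile_small: "length \<pi>s \<le> Z" "\<forall>\<pi>\<in>set \<pi>s. small Z \<pi>"
begin

lemma profile_lengths: "\<forall>\<pi>\<in>set \<pi>s. length \<pi> \<le> Z"
  using profile_small by (auto simp: small_def)

lemma first_ranking_small: "small Z (first_ranking \<pi>s)"
  using profile_small by (cases \<pi>s) (auto simp: first_ranking_def small_def)

lemma compute_some_prefers:
  assumes "input_size (enc_nat a) \<le> Z" "input_size (enc_nat b) \<le> Z"
  shows "prog_computes 4 [enc_rankings \<pi>s, enc_nat a, enc_nat b]
           (enc_bool (\<exists>\<pi>\<in>set \<pi>s. prefers \<pi> a b)) (t_support Z)"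
  by (rule computes_mono[OF compute_some_prefers_aux[OF assms profile_lengths]])
     (use profile_small in \<open>auto simp: t_support_def intro!: mult_le_mono\<close>)

lemma compute_support:
  assumes "input_size (enc_nat a) \<le> Z" "input_size (enc_nat b) \<le> Z"
  shows "prog_computes 6 [enc_rankings \<pi>s, enc_nat a, enc_nat b, enc_unary n]
           (enc_unary (support \<pi>s a b + n)) (t_support Z)"
  by (rule computes_mono[OF compute_support_aux[OF assms profile_lengths]])
     (use profile_small in \<open>auto simp: t_support_def intro!: mult_le_mono\<close>)

lemma compute_admissible_aux:
  assumes "input_size (enc_nat c) \<le> Z" "length q \<le> Z" "\<forall>x\<in>set D. input_size (enc_nat x) \<le> Z"
  shows "prog_computes 5 [enc_nats D, enc_rankings \<pi>s, enc_nat c, enc_nats q]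
           (enc_bool (\<forall>d\<in>set D. d \<in> set q \<or> (\<exists>\<pi>\<in>set \<pi>s. prefers \<pi> d c)))
           ((t_member Z + t_support Z + 20) * Suc (length D))"
  using assms(3)
proof (induction D)
  case Nil
  show ?case by (rule computesI) (auto simp: admissible_body_def)
next
  case (Cons d D)
  then have d: "input_size (enc_nat d) \<le> Z" "\<forall>x\<in>set D. input_size (enc_nat x) \<le> Z" by auto
  note facts = computesD[OF Cons.IH[OF d(2)]] computesD[OF compute_member[OF d(1) assms(2)]]
    computesD[OF compute_some_prefers[OF d(1) assms(1)]]
  from facts show ?case by (intro computesI) (auto simp: admissible_body_def)
qed

lemma compute_admissible:
  assumes "input_size (enc_nat c) \<le> Z" "length (c # q) \<le> Z"
  shows "prog_computes 5 [enc_nats (first_ranking \<pi>s), enc_rankings \<pi>s, enc_nat c, enc_nats (c # q)]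
           (enc_bool (admissible \<pi>s c q)) (t_admissible Z)"
  using computes_mono[OF compute_admissible_aux[OF assms, of "first_ranking \<pi>s"], of "t_admissible Z"]
    first_ranking_small
  by (auto simp: small_def t_admissible_def admissible_def simp del: mult_Suc_right)

lemma compute_supports_aux:
  assumes "input_size (enc_nat c) \<le> Z" "\<forall>x\<in>set q. input_size (enc_nat x) \<le> Z"
  shows "prog_computes 7 [enc_nats q, enc_rankings \<pi>s, enc_nat c, enc_unary n]
           (enc_unary ((\<Sum>d\<leftarrow>q. support \<pi>s d c) + n)) ((t_support Z + 20) * Suc (length q))"
  using assms(2)
proof (induction q arbitrary: n)
  case Nil
  show ?case by (rule computesI) (auto simp: supports_body_def)
next
  case (Cons d q)
  then have d: "input_size (enc_nat d) \<le> Z" "\<forall>x\<in>set q. input_size (enc_nat x) \<le> Z" by auto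
  note facts = computesD[OF Cons.IH[OF d(2), of "support \<pi>s d c + n"]]
    computesD[OF compute_support[OF d(1) assms(1), of n]]
  from facts show ?case by (intro computesI) (auto simp: supports_body_def algebra_simps)
qed

lemma compute_supports:
  assumes "input_size (enc_nat c) \<le> Z" "small Z q"
  shows "prog_computes 7 [enc_nats q, enc_rankings \<pi>s, enc_nat c, enc_unary n]
           (enc_unary ((\<Sum>d\<leftarrow>q. support \<pi>s d c) + n)) (t_supports Z)"
  by (rule computes_mono[OF compute_supports_aux])
     (use assms in \<open>auto simp: small_def t_supports_def intro!: mult_le_mono\<close>)

lemma compute_score_aux:
  assumes "small Z q"
  shows "prog_computes 8 [enc_nats q, enc_rankings \<pi>s] (enc_unary (score \<pi>s q))
           ((t_supports Z + 20) * Suc (length q))"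
  using assms
proof (induction q)
  case Nil
  show ?case by (rule computesI) (auto simp: score_body_def)
next
  case (Cons c q)
  note c = small_Cons[OF Cons.prems, THEN conjunct1] small_Cons[OF Cons.prems, THEN conjunct2]
  note facts = computesD[OF Cons.IH[OF c(2)]] computesD[OF compute_supports[OF c, of "score \<pi>s q"]]
  from facts show ?case by (intro computesI) (auto simp: score_body_def)
qed

lemma compute_score:
  assumes "small Z q"
  shows "prog_computes 8 [enc_nats q, enc_rankings \<pi>s] (enc_unary (score \<pi>s q)) (t_score Z)"
  by (rule computes_mono[OF compute_score_aux[OF assms]])
     (use assms in \<open>auto simp: small_def t_score_def intro!: mult_le_mono\<close>)

lemma compute_leq_score:
  assumes "small Z q"
  shows "prog_computes 9 [enc_unary (score \<pi>s q), enc_unary n] (enc_bool (score \<pi>s q \<le> n)) (t_leq Z)"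
proof (rule computes_mono[OF compute_leq])
  have "score \<pi>s q \<le> length q * length q * length \<pi>s" by (rule score_le)
  also have "\<dots> \<le> Z * Z * Z"
    using assms profile_small by (intro mult_le_mono) (auto simp: small_def)
  finally show "20 * Suc (score \<pi>s q) \<le> t_leq Z" by (auto simp: t_leq_def)
qed

lemma compute_same_aux:
  assumes "length p \<le> Z" "length q \<le> Z" "\<forall>x\<in>set D. input_size (enc_nat x) \<le> Z"
  shows "prog_computes 10 [enc_nats D, enc_nats p, enc_nats q]
           (enc_bool (set p \<inter> set D = set q \<inter> set D)) ((2 * t_member Z + 20) * Suc (length D))"
  using assms(3)
proof (induction D)
  case Nil
  show ?case by (rule computesI) (auto simp: same_body_def)
next
  case (Cons d D)
  then have d: "input_size (enc_nat d) \<le> Z" "\<forall>x\<in>set D. input_size (enc_nat x) \<le> Z" by auto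
  have eq: "set p \<inter> set (d # D) = set q \<inter> set (d # D) \<longleftrightarrow>
      (d \<in> set p \<longleftrightarrow> d \<in> set q) \<and> set p \<inter> set D = set q \<inter> set D"
    by auto
  note facts = computesD[OF Cons.IH[OF d(2)]] computesD[OF compute_member[OF d(1) assms(1)]]
    computesD[OF compute_member[OF d(1) assms(2)]]
  from facts show ?case unfolding eq by (intro computesI) (auto simp: same_body_def)
qed

lemma compute_same:
  assumes "length p \<le> Z" "length q \<le> Z"
  shows "prog_computes 10 [enc_nats (first_ranking \<pi>s), enc_nats p, enc_nats q]
           (enc_bool (key \<pi>s p = key \<pi>s q)) (t_same Z)"
  unfolding key_def
  by (rule computes_mono[OF compute_same_aux[OF assms]])
     (use first_ranking_small in \<open>auto simp: small_def t_same_def intro!: mult_le_mono\<close>)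

lemma compute_combine:
  assumes "s \<noteq> []" "b \<noteq> []" "small Z (hd s)" "small Z (hd b)" "length s \<le> R" "R > 0"
  shows "prog_computes 13 [enc_rankings s, enc_rankings b, enc_rankings \<pi>s, enc_unary R]
           (enc_rankings (combine \<pi>s R s b)) (R * t_combine Z)"
proof -
  let ?s = "score \<pi>s (hd s)" and ?b = "score \<pi>s (hd b)"
  note facts = computesD[OF compute_score[OF assms(3)]] computesD[OF compute_score[OF assms(4)]]
    computesD[OF compute_leq_score[OF assms(3), of ?b]]
    computesD[OF compute_leq_score[OF assms(4), of ?s]]
    computesD[OF compute_append[of enc_nats s b, folded enc_rankings_def]]
    computesD[OF compute_take[of R enc_nats "s @ b", folded enc_rankings_def]]
  \<comment> \<open>The 140 in \<open>t_combine\<close> splits into 60 for the body and 80 for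
    append and take: their costs \<open>20 * Suc (length s)\<close> and \<open>20 * Suc R\<close>
    are at most \<open>40 * R\<close> each, as \<open>length s \<le> R\<close> and
    \<open>R > 0\<close>.\<close>
  have "4 * t_score Z + 2 * t_leq Z + 60 \<le> R * (4 * t_score Z + 2 * t_leq Z + 60)"
    using assms(6) by simp
  then have "4 * t_score Z + 2 * t_leq Z + 60 + 80 * R \<le> R * t_combine Z"
    by (simp add: t_combine_def algebra_simps)
  then have bound: "4 * t_score Z + 2 * t_leq Z + 20 * Suc R + 20 * Suc (length s) + 60 \<le> R * t_combine Z"
    using assms(5,6) by simp
  show ?thesis
    using facts assms(1,2) bound
    by (intro computesI) (auto simp: combine_body_def combine_def)
qed

end

text \<open>The part of the invariant that the running time depends on, kept apart from optimality:
  distinct keys limit the number of states, and validity limits the size of the suffixes.\<close>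

definition well_formed :: "'a list list \<Rightarrow> 'a list \<Rightarrow> nat \<Rightarrow> 'a list list list \<Rightarrow> bool" where
  "well_formed \<pi>s cs R L \<longleftrightarrow>
     (\<forall>s\<in>set L. s \<noteq> [] \<and> length s \<le> R \<and> (\<forall>q\<in>set s. valid \<pi>s cs q)) \<and>
     distinct (map (\<lambda>s. key \<pi>s (hd s)) L)"

text \<open>Replaces the recursive search by its two outcomes, a new state at the end or one state
  merged in place. Both the running-time invariant and the optimality invariant are checked along
  this split.\<close>

lemma insert_state_cases:
  obtains (new) "\<forall>s\<in>set L. key \<pi>s (hd s) \<noteq> key \<pi>s (hd b)" "insert_state \<pi>s R L b = L @ [b]"
  | (old) L1 s L2 where "L = L1 @ s # L2" "key \<pi>s (hd s) = key \<pi>s (hd b)"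
      "insert_state \<pi>s R L b = L1 @ combine \<pi>s R s b # L2"
proof (induction L arbitrary: thesis)
  case Nil
  then show ?case by simp
next
  case (Cons s L)
  show ?case
  proof (cases "key \<pi>s (hd s) = key \<pi>s (hd b)")
    case True
    then show ?thesis using Cons.prems(2)[of "[]" s L] by simp
  next
    case False
    show ?thesis
    proof (rule Cons.IH)
      assume "\<forall>s\<in>set L. key \<pi>s (hd s) \<noteq> key \<pi>s (hd b)" "insert_state \<pi>s R L b = L @ [b]"
      then show ?thesis using False Cons.prems(1) by simp
    next
      fix L1 s' L2
      assume "L = L1 @ s' # L2" "key \<pi>s (hd s') = key \<pi>s (hd b)"
        "insert_state \<pi>s R L b = L1 @ combine \<pi>s R s' b # L2"
      then show ?thesis using False Cons.prems(2)[of "s # L1" s' L2] by simp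
    qed
  qed
qed

lemma combine_props:
  assumes "s \<noteq> []" "b \<noteq> []" "key \<pi>s (hd s) = key \<pi>s (hd b)" "R > 0" "length s \<le> R" "length b \<le> R"
  shows "combine \<pi>s R s b \<noteq> []" "length (combine \<pi>s R s b) \<le> R"
    "set (combine \<pi>s R s b) \<subseteq> set s \<union> set b" "key \<pi>s (hd (combine \<pi>s R s b)) = key \<pi>s (hd b)"
  using assms by (auto simp: combine_def dest: in_set_takeD)

lemma well_formed_add_state:
  assumes L: "well_formed \<pi>s cs R L" and R: "R > 0"
    and b: "length b \<le> R" "\<forall>q\<in>set b. valid \<pi>s cs q"
  shows "well_formed \<pi>s cs R (add_state \<pi>s R L b)"
proof (cases "b = []")
  case False
  show ?thesis
  proof (cases rule: insert_state_cases[of L \<pi>s b R])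
    case new
    then show ?thesis using assms False by (auto simp: well_formed_def add_state_def)
  next
    case (old L1 s L2)
    then have "s \<noteq> []" "length s \<le> R" "\<forall>q\<in>set s. valid \<pi>s cs q"
      using L by (auto simp: well_formed_def)
    note combine_props[OF this(1) False old(2) R this(2) b(1)] this(3)
    then show ?thesis using old False L b
      by (auto simp: well_formed_def add_state_def)
  qed
qed (use L in \<open>simp add: add_state_def\<close>)

lemma extend_props:
  assumes "\<forall>q\<in>set s. valid \<pi>s cs q" "c \<in> set cs"
  shows "length (extend \<pi>s s c) \<le> length s" "\<forall>q\<in>set (extend \<pi>s s c). valid \<pi>s cs q"
  using assms by (auto simp: extend_def)

lemma well_formed_extend_all:
  assumes "well_formed \<pi>s cs R L" "R > 0" "\<forall>q\<in>set s. valid \<pi>s cs q" "length s \<le> R" "set cs' \<subseteq> set cs"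
  shows "well_formed \<pi>s cs R (extend_all \<pi>s R cs' s L)"
  using assms(1,5)
proof (induction cs' arbitrary: L)
  case (Cons c cs')
  note e = extend_props[OF assms(3), of c]
  have "well_formed \<pi>s cs R (add_state \<pi>s R L (extend \<pi>s s c))"
    using Cons.prems e assms(4) by (intro well_formed_add_state assms(2)) auto
  then show ?case using Cons by (simp add: extend_all_def)
qed (simp add: extend_all_def)

lemma well_formed_next_layer:
  assumes "well_formed \<pi>s cs R L'" "R > 0"
    "\<forall>s\<in>set L. length s \<le> R \<and> (\<forall>q\<in>set s. valid \<pi>s cs q)"
  shows "well_formed \<pi>s cs R (next_layer \<pi>s R cs L L')"
  using assms(1,3)
proof (induction L arbitrary: L')
  case (Cons s L)
  then have "well_formed \<pi>s cs R (extend_all \<pi>s R cs s L')"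
    using assms(2) by (intro well_formed_extend_all) auto
  then show ?case using Cons by (simp add: next_layer_def)
qed (simp add: next_layer_def)

lemma well_formed_layer: "R > 0 \<Longrightarrow> well_formed \<pi>s cs R (layer \<pi>s R cs k)"
proof (induction k)
  case (Suc k)
  then show ?case
    by (auto intro!: well_formed_next_layer) (auto simp: well_formed_def)
qed (auto simp: well_formed_def)

text \<open>Only the polynomial parts; the number \<open>N\<close> of states and the cut-off
  \<open>R\<close> remain separate factors. The factors 2 absorb the successor in bounds such as
  \<open>Suc (length L) \<le> N * 2\<close>.\<close>

definition t_insert :: "nat \<Rightarrow> nat" where "t_insert Z = 2 * (t_same Z + 40) + t_combine Z"
definition t_extend :: "nat \<Rightarrow> nat" where
  "t_extend Z = 2 * (t_member Z + t_admissible Z + 40)"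
definition t_extend_all :: "nat \<Rightarrow> nat" where
  "t_extend_all Z = (t_extend Z + t_insert Z + 80) * Suc Z"
definition t_next_layer :: "nat \<Rightarrow> nat" where "t_next_layer Z = 2 * (t_extend_all Z + 40)"
definition t_iterate :: "nat \<Rightarrow> nat" where "t_iterate Z = (t_next_layer Z + 40) * Suc Z"

section \<open>Cost of building the layers, relative to a bound on the number of states\<close>

context
  fixes Z N R :: nat and \<pi>s :: "nat list list" and cs :: "nat list"
  assumes profile_small: "length \<pi>s \<le> Z" "\<forall>\<pi>\<in>set \<pi>s. small Z \<pi>"
    and candidates_small: "small Z cs"
    \<comment> \<open>The exponential quantity enters only through the abstract number
      \<open>N\<close>; the unanimity width comes in when this assumption is discharged by counting
      upsets.\<close>
    and few_states: "\<And>L. well_formed \<pi>s cs R L \<Longrightarrow> length L \<le> N"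
    and pos: "R > 0" "N > 0"
begin

lemma valid_small: "valid \<pi>s cs q \<Longrightarrow> small Z q"
  using candidates_small valid_subset[of \<pi>s cs q] valid_length[of \<pi>s cs q]
  by (auto simp: small_def)

text \<open>The search ends at the first state with the same key, so the price
  \<open>R * t_combine Z\<close> of merging is paid at most once.\<close>

lemma compute_insert_aux:
  assumes "\<forall>s\<in>set L. s \<noteq> [] \<and> length s \<le> R \<and> small Z (hd s)" "b \<noteq> []" "small Z (hd b)"
  shows "prog_computes 14 [enc_layer L, enc_rankings b, enc_rankings \<pi>s, enc_unary R]
           (enc_layer (insert_state \<pi>s R L b)) ((t_same Z + 40) * Suc (length L) + R * t_combine Z)"
  using assms(1)
proof (induction L)
  case Nil
  show ?case by (rule computesI) (auto simp: insert_body_def val_fst_enc_profile[of \<pi>s])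
next
  case (Cons s L)
  then have s: "s \<noteq> []" "length s \<le> R" "small Z (hd s)" by auto
  have "length (hd s) \<le> Z" "length (hd b) \<le> Z" using s assms(3) by (auto simp: small_def)
  note same = compute_same[OF profile_small this]
  note facts = computesD[OF same]
    computesD[OF compute_combine[OF profile_small s(1) assms(2) s(3) assms(3) s(2) pos(1)]]
    computesD[OF Cons.IH]
  from facts s(1) assms(2) Cons.prems show ?case
    by (intro computesI) (auto simp: insert_body_def val_fst_enc_profile[of \<pi>s])
qed

lemma compute_insert:
  assumes "well_formed \<pi>s cs R L" "b \<noteq> []" "\<forall>q\<in>set b. valid \<pi>s cs q"
  shows "prog_computes 14 [enc_layer L, enc_rankings b, enc_rankings \<pi>s, enc_unary R]
           (enc_layer (insert_state \<pi>s R L b)) (N * R * t_insert Z)"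
proof (rule computes_mono[OF compute_insert_aux])
  show "\<forall>s\<in>set L. s \<noteq> [] \<and> length s \<le> R \<and> small Z (hd s)"
    using assms(1) by (auto simp: well_formed_def intro: valid_small)
  have "Suc (length L) \<le> N * R * 2"
  proof -
    have "Suc (length L) \<le> N * 1 * 2" using few_states[OF assms(1)] pos by simp
    also have "\<dots> \<le> N * R * 2" using pos by (intro mult_le_mono) auto
    finally show ?thesis .
  qed
  then have "(t_same Z + 40) * Suc (length L) \<le> (t_same Z + 40) * (N * R * 2)"
    by (rule mult_le_mono2)
  moreover have "R * t_combine Z \<le> N * R * t_combine Z" using pos by simp
  ultimately have "(t_same Z + 40) * Suc (length L) + R * t_combine Z
      \<le> (t_same Z + 40) * (N * R * 2) + N * R * t_combine Z" by (rule add_mono)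
  also have "\<dots> = N * R * t_insert Z" by (simp add: t_insert_def algebra_simps)
  finally show "(t_same Z + 40) * Suc (length L) + R * t_combine Z \<le> N * R * t_insert Z" .
qed (use assms in \<open>auto intro: valid_small\<close>)

lemma compute_extend_aux:
  assumes "\<forall>q\<in>set s. valid \<pi>s cs q" "c \<in> set cs"
  shows "prog_computes 15 [enc_rankings s, enc_nat c, enc_rankings \<pi>s]
           (enc_rankings (extend \<pi>s s c)) ((t_member Z + t_admissible Z + 40) * Suc (length s))"
  using assms(1)
proof (induction s)
  case Nil
  show ?case by (rule computesI) (auto simp: extend_body_def val_fst_enc_profile[of \<pi>s] extend_def)
next
  case (Cons q s)
  have c: "input_size (enc_nat c) \<le> Z" using assms(2) candidates_small by (auto simp: small_def)
  have q: "valid \<pi>s cs q" using Cons.prems by simp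
  then have lq: "length q \<le> Z" using valid_small by (auto simp: small_def)
  note member = computesD[OF compute_member[OF c lq]]
  note IH = computesD[OF Cons.IH]
  show ?case
  proof (cases "c \<in> set q")
    case True
    then show ?thesis using member IH Cons.prems
      by (intro computesI) (auto simp: extend_body_def val_fst_enc_profile[of \<pi>s] extend_def)
  next
    case False
    \<comment> \<open>\<open>c # q\<close> is still to be tested for admissibility, so
      \<open>valid_length\<close> does not apply to it; its length is bounded by being a list of
      distinct candidates.\<close>
    have "length (c # q) \<le> length cs"
      using valid_subset[OF q] valid_distinct[OF q] False assms(2)
      by (metis card_length card_mono distinct.simps(2) distinct_card finite_set le_trans
          insert_subset list.simps(15))
    then have "length (c # q) \<le> Z" using candidates_small by (auto simp: small_def)
    note adm = computesD[OF compute_admissible[OF profile_small c this]]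
    then show ?thesis using False member IH Cons.prems
      by (intro computesI) (auto simp: extend_body_def val_fst_enc_profile[of \<pi>s] extend_def)
  qed
qed

lemma compute_extend:
  assumes "\<forall>q\<in>set s. valid \<pi>s cs q" "c \<in> set cs" "length s \<le> R"
  shows "prog_computes 15 [enc_rankings s, enc_nat c, enc_rankings \<pi>s]
           (enc_rankings (extend \<pi>s s c)) (R * t_extend Z)"
proof (rule computes_mono[OF compute_extend_aux[OF assms(1,2)]])
  have "Suc (length s) \<le> R * 2" using assms(3) pos by simp
  then have "(t_member Z + t_admissible Z + 40) * Suc (length s)
      \<le> (t_member Z + t_admissible Z + 40) * (R * 2)" by (rule mult_le_mono2)
  then show "(t_member Z + t_admissible Z + 40) * Suc (length s) \<le> R * t_extend Z"
    by (simp add: t_extend_def algebra_simps)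
qed

lemma compute_extend_all_aux:
  assumes "\<forall>q\<in>set s. valid \<pi>s cs q" "length s \<le> R" "well_formed \<pi>s cs R L" "set cs' \<subseteq> set cs"
  shows "prog_computes 16
           [enc_nats cs', enc_rankings s, enc_layer L, enc_rankings \<pi>s, enc_unary R]
           (enc_layer (extend_all \<pi>s R cs' s L))
           ((R * t_extend Z + N * R * t_insert Z + 40) * Suc (length cs'))"
  using assms(3,4)
proof (induction cs' arbitrary: L)
  case Nil
  show ?case by (rule computesI) (auto simp: extend_all_body_def extend_all_def)
next
  case (Cons c cs')
  then have c: "c \<in> set cs" by simp
  note e = extend_props[OF assms(1) c]
  \<comment> \<open>The layer under construction has at most \<open>N\<close> states at every
    moment, not just when finished, because each single insertion preserves the invariant.\<close>
  have wf: "well_formed \<pi>s cs R (add_state \<pi>s R L (extend \<pi>s s c))"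
    using e assms(2) Cons.prems pos by (intro well_formed_add_state) auto
  note IH = computesD[OF Cons.IH[OF wf]]
  note ext = computesD[OF compute_extend[OF assms(1) c assms(2)]]
  show ?case
  proof (cases "extend \<pi>s s c = []")
    case True
    then show ?thesis using ext IH Cons.prems
      by (intro computesI) (auto simp: extend_all_body_def extend_all_def add_state_def)
  next
    case False
    note ins = computesD[OF compute_insert[OF Cons.prems(1) False e(2)]]
    show ?thesis using False ext IH ins Cons.prems
      by (intro computesI) (auto simp: extend_all_body_def extend_all_def add_state_def)
  qed
qed

lemma compute_extend_all:
  assumes "\<forall>q\<in>set s. valid \<pi>s cs q" "length s \<le> R" "well_formed \<pi>s cs R L"
  shows "prog_computes 16
           [enc_nats cs, enc_rankings s, enc_layer L, enc_rankings \<pi>s, enc_unary R]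
           (enc_layer (extend_all \<pi>s R cs s L)) (N * R * t_extend_all Z)"
proof (rule computes_mono[OF compute_extend_all_aux[OF assms order.refl]])
  have "R * t_extend Z \<le> N * R * t_extend Z" "40 \<le> N * R * 80" using pos by auto
  then have "R * t_extend Z + N * R * t_insert Z + 40 \<le> N * R * (t_extend Z + t_insert Z + 80)"
    unfolding distrib_left by linarith
  moreover have "Suc (length cs) \<le> Suc Z" using candidates_small by (auto simp: small_def)
  ultimately have "(R * t_extend Z + N * R * t_insert Z + 40) * Suc (length cs)
      \<le> N * R * (t_extend Z + t_insert Z + 80) * Suc Z"
    by (rule mult_le_mono)
  then show "(R * t_extend Z + N * R * t_insert Z + 40) * Suc (length cs) \<le> N * R * t_extend_all Z"
    by (simp only: t_extend_all_def mult.assoc)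
qed

lemma compute_next_layer_aux:
  assumes "\<forall>s\<in>set L. length s \<le> R \<and> (\<forall>q\<in>set s. valid \<pi>s cs q)" "well_formed \<pi>s cs R L'"
  shows "prog_computes 17 [enc_layer L, enc_layer L', enc_nats cs, enc_rankings \<pi>s, enc_unary R]
           (enc_layer (next_layer \<pi>s R cs L L')) ((N * R * t_extend_all Z + 40) * Suc (length L))"
  using assms
proof (induction L arbitrary: L')
  case Nil
  show ?case by (rule computesI) (auto simp: next_layer_body_def next_layer_def)
next
  case (Cons s L)
  then have s: "\<forall>q\<in>set s. valid \<pi>s cs q" "length s \<le> R" by auto
  note ext = computesD[OF compute_extend_all[OF s Cons.prems(2)]]
  have "well_formed \<pi>s cs R (extend_all \<pi>s R cs s L')"
    using Cons.prems s pos by (intro well_formed_extend_all) auto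
  note IH = computesD[OF Cons.IH[OF _ this]]
  show ?case using ext IH Cons.prems(1)
    by (intro computesI) (auto simp: next_layer_body_def next_layer_def)
qed

text \<open>One factor \<open>N\<close> counts the states of the old layer, the other the linear
  search through the new layer at every insertion.\<close>

lemma compute_next_layer:
  assumes "well_formed \<pi>s cs R L"
  shows "prog_computes 17 [enc_layer L, Atom, enc_nats cs, enc_rankings \<pi>s, enc_unary R]
           (enc_layer (next_layer \<pi>s R cs L [])) (N * N * R * t_next_layer Z)"
proof -
  have "Suc (length L) \<le> N * 2" using few_states[OF assms] pos by simp
  moreover have "40 \<le> N * R * 40" using pos by simp
  then have "N * R * t_extend_all Z + 40 \<le> N * R * (t_extend_all Z + 40)"
    unfolding distrib_left by linarith
  ultimately have "(N * R * t_extend_all Z + 40) * Suc (length L)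
      \<le> N * R * (t_extend_all Z + 40) * (N * 2)" by (intro mult_le_mono)
  also have "\<dots> = N * N * R * t_next_layer Z" by (simp add: t_next_layer_def algebra_simps)
  finally show ?thesis
    using compute_next_layer_aux[of L "[]"] assms
    by (auto simp: well_formed_def intro: computes_mono)
qed

text \<open>\<open>xs\<close> is a counter made of list cells, which lets the candidate list itself
  count the layers.\<close>

lemma compute_iterate_aux:
  "prog_computes 18
     [enc_nats xs, enc_layer (layer \<pi>s R cs k), enc_nats cs, enc_rankings \<pi>s, enc_unary R]
     (enc_layer (layer \<pi>s R cs (k + length xs))) ((N * N * R * t_next_layer Z + 40) * Suc (length xs))"
proof (induction xs arbitrary: k)
  case Nil
  show ?case by (rule computesI) (auto simp: iterate_body_def)
next
  case (Cons x xs)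
  note facts = computesD[OF compute_next_layer[OF well_formed_layer[OF pos(1)], of k]]
    computesD[OF Cons.IH[of "Suc k"]]
  from facts show ?case by (intro computesI) (auto simp: iterate_body_def)
qed

lemma compute_iterate:
  "prog_computes 18
     [enc_nats cs, Pair (Pair Atom Atom) Atom, enc_nats cs, enc_rankings \<pi>s, enc_unary R]
     (enc_layer (layer \<pi>s R cs (length cs))) (N * N * R * t_iterate Z)"
proof -
  have "Suc (length cs) \<le> Suc Z" using candidates_small by (auto simp: small_def)
  moreover have "40 \<le> N * N * R * 40" using pos by simp
  then have "N * N * R * t_next_layer Z + 40 \<le> N * N * R * (t_next_layer Z + 40)"
    unfolding distrib_left by linarith
  ultimately have "(N * N * R * t_next_layer Z + 40) * Suc (length cs)
      \<le> N * N * R * (t_next_layer Z + 40) * Suc Z" by (intro mult_le_mono)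
  also have "\<dots> = N * N * R * t_iterate Z" by (simp only: t_iterate_def mult.assoc)
  finally show ?thesis
    using compute_iterate_aux[of cs 0] by (auto intro: computes_mono)
qed

end

text \<open>A unary number is a list of dummies, so the function for appending lists doubles as
  addition.\<close>

lemma enc_unary_eq_list: "enc_unary n = enc_list (\<lambda>_. Atom) (replicate n ())"
  by (induction n) auto

lemma compute_append_unary:
  "prog_computes 12 [enc_unary m, enc_unary n] (enc_unary (m + n)) (20 * Suc m)"
  using compute_append[of "\<lambda>_. Atom" "replicate m ()" "replicate n ()"]
  by (simp add: enc_unary_eq_list replicate_add)

text \<open>Doubling by appending costs time linear in the number, and the recursive call handles
  half of it, so the total is a geometric sum: linear in \<open>r\<close>, though not in the size of
  its binary code.\<close>

lemma compute_unary: "prog_computes 19 [enc_nat r] (enc_unary r) (200 * r + 20)"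
proof (induction r rule: less_induct)
  case (less r)
  show ?case
  proof (cases "r = 0")
    case True
    then show ?thesis by (intro computesI) (auto simp: unary_body_def enc_nat.simps)
  next
    case False
    define h where "h = r div 2"
    have "h < r" using False by (simp add: h_def)
    note IH = computesD[OF less.IH[OF this]]
    have r: "r = h + (h + r mod 2)" unfolding h_def by presburger
    note app = computesD[OF compute_append_unary[of h "r mod 2"]]
      computesD[OF compute_append_unary[of h "h + r mod 2"]]
    have bit: "enc_unary (r mod 2) = (if odd r then Pair Atom Atom else Atom)"
      by (cases "odd r") (auto simp: odd_iff_mod_2_eq_one even_iff_mod_2_eq_zero)
    \<comment> \<open>What has to be shown amounts to \<open>240 * h + 60 \<le> 200 * r\<close>.
      From \<open>2 * h \<le> r\<close> the first term is at most \<open>120 * r\<close>, and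
      \<open>1 \<le> r\<close> leaves room for the constant.\<close>
    have "2 * h \<le> r" "1 \<le> r" using False by (simp_all add: h_def)
    then have "200 * h + 20 + 40 * Suc h + 20 \<le> 200 * r + 20" by simp
    then show ?thesis using IH app False r
      by (intro computesI)
         (auto simp: unary_body_def enc_nat.simps[of r] h_def[symmetric] bit[symmetric] split: if_splits)
  qed
qed

section \<open>Optimality\<close>

lemma prefers_antisym: "distinct \<pi> \<Longrightarrow> prefers \<pi> a b \<Longrightarrow> \<not> prefers \<pi> b a"
  by (induction \<pi>) (auto simp: prefers_Cons dest: prefers_in_set)

lemma prefers_trans: "distinct \<pi> \<Longrightarrow> prefers \<pi> a b \<Longrightarrow> prefers \<pi> b c \<Longrightarrow> prefers \<pi> a c"
  by (induction \<pi>) (auto simp: prefers_Cons dest: prefers_in_set)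

lemma prefers_total: "a \<in> set \<pi> \<Longrightarrow> b \<in> set \<pi> \<Longrightarrow> a \<noteq> b \<Longrightarrow> prefers \<pi> a b \<or> prefers \<pi> b a"
  by (induction \<pi>) (auto simp: prefers_Cons)

text \<open>The pairs in disagreement either start with \<open>c\<close> or lie inside
  \<open>q\<close>; the two kinds are disjoint because \<open>c\<close> does not occur in
  \<open>q\<close>.\<close>

lemma kendall_tau_Cons:
  assumes "distinct (c # q)"
  shows "kendall_tau (c # q) \<pi> = length (filter (\<lambda>d. prefers \<pi> d c) q) + kendall_tau q \<pi>"
proof -
  let ?A = "(\<lambda>d. (c, d)) ` set (filter (\<lambda>d. prefers \<pi> d c) q)"
  let ?B = "{(a, b). prefers q a b \<and> prefers \<pi> b a}"
  have "{(a, b). prefers (c # q) a b \<and> prefers \<pi> b a} = ?A \<union> ?B"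
    by (auto simp: prefers_Cons)
  moreover have "?A \<inter> ?B = {}" using assms by (auto dest: prefers_in_set)
  moreover have "finite ?B"
    by (rule finite_subset[of _ "set q \<times> set q"]) (auto dest: prefers_in_set)
  moreover have "card ?A = length (filter (\<lambda>d. prefers \<pi> d c) q)"
    using assms by (subst card_image) (auto simp: inj_on_def distinct_card simp del: set_filter)
  ultimately show ?thesis by (simp add: kendall_tau_def card_Un_disjoint)
qed

lemma support_Cons: "support (\<pi> # \<pi>s) a b = of_bool (prefers \<pi> a b) + support \<pi>s a b"
  by (simp add: support_def)

text \<open>Interchange of summation: \<open>score\<close> recurses over candidates, the Kemeny
  score sums over rankings. Peeling off one ranking at a time links the two.\<close>

lemma score_Cons: "distinct q \<Longrightarrow> score (\<pi> # \<pi>s) q = kendall_tau q \<pi> + score \<pi>s q"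
proof (induction q)
  case Nil
  have "{(a, b). prefers [] a b \<and> prefers \<pi> b a} = {}" by auto
  then show ?case by (simp add: kendall_tau_def)
next
  case (Cons c q)
  have "(\<Sum>d\<leftarrow>q. of_bool (prefers \<pi> d c)) = length (filter (\<lambda>d. prefers \<pi> d c) q)"
    by (induction q) auto
  then show ?case using Cons kendall_tau_Cons[OF Cons.prems]
    by (simp add: support_Cons sum_list_addf)
qed

lemma kemeny_score_eq: "distinct q \<Longrightarrow> kemeny_score (mset \<pi>s) q = score \<pi>s q"
proof (induction \<pi>s)
  case Nil
  have "score [] q = 0" by (induction q) (auto simp: support_def)
  then show ?case by (simp add: kemeny_score_def)
next
  case (Cons \<pi> \<pi>s)
  then show ?case by (simp add: score_Cons kemeny_score_def)
qed

lemma score_append: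
  "score \<pi>s (xs @ ys) = score \<pi>s xs + score \<pi>s ys + (\<Sum>x\<leftarrow>xs. \<Sum>y\<leftarrow>ys. support \<pi>s y x)"
  by (induction xs) auto

lemma support_mono:
  assumes "\<And>\<pi>. \<pi> \<in> set \<pi>s \<Longrightarrow> prefers \<pi> a b \<Longrightarrow> prefers \<pi> a' b'"
  shows "support \<pi>s a b \<le> support \<pi>s a' b'"
  using assms by (induction \<pi>s) (auto simp: support_Cons support_def[of "[]"] intro!: add_mono)

text \<open>The pair of \<open>c\<close> and \<open>d\<close> gains strictly, as all rankings
  support \<open>c\<close> over \<open>d\<close> and none the converse. For \<open>y\<close> in
  between, transitivity applies in every ranking: whoever puts \<open>y\<close> before
  \<open>c\<close> also puts it before \<open>d\<close>, and whoever puts \<open>d\<close> before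
  \<open>y\<close> also puts \<open>c\<close> before it. All other pairs keep their order.\<close>

lemma score_swap_less:
  assumes "\<pi>s \<noteq> []" "\<And>\<pi>. \<pi> \<in> set \<pi>s \<Longrightarrow> distinct \<pi> \<and> prefers \<pi> c d"
  shows "score \<pi>s (xs @ c # ys @ d # zs) < score \<pi>s (xs @ d # ys @ c # zs)"
proof -
  have "support \<pi>s c d = length \<pi>s" using assms(2) by (simp add: support_def)
  moreover have "filter (\<lambda>\<pi>. prefers \<pi> d c) \<pi>s = []"
    using assms(2) prefers_antisym by (metis filter_False)
  then have "support \<pi>s d c = 0" by (simp add: support_def)
  ultimately have cd: "support \<pi>s d c < support \<pi>s c d" using assms(1) by simp
  have "support \<pi>s y c \<le> support \<pi>s y d" "support \<pi>s d y \<le> support \<pi>s c y" for y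
    by (rule support_mono, use assms(2) prefers_trans in metis)+
  then have "(\<Sum>y\<leftarrow>ys. support \<pi>s y c) \<le> (\<Sum>y\<leftarrow>ys. support \<pi>s y d)"
       "(\<Sum>y\<leftarrow>ys. support \<pi>s d y) \<le> (\<Sum>y\<leftarrow>ys. support \<pi>s c y)"
    by (simp_all add: sum_list_mono)
  with cd show ?thesis
    by (simp add: score_append sum_list_addf)
qed

section \<open>Exchanging tails of the same class\<close>

locale profile =
  fixes cs :: "'a list" and \<pi>s :: "'a list list"
  assumes distinct_cs: "distinct cs"
    and rankings: "\<pi> \<in> set \<pi>s \<Longrightarrow> distinct \<pi> \<and> set \<pi> = set cs"
begin

lemma set_first_ranking: "set (first_ranking \<pi>s) = (if \<pi>s = [] then {} else set cs)"
  using rankings by (cases \<pi>s) (auto simp: first_ranking_def)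

lemma key_eq: "set q \<subseteq> set cs \<Longrightarrow> key \<pi>s q = (if \<pi>s = [] then {} else set q)"
  by (auto simp: key_def set_first_ranking)

lemma key_Cons: "key \<pi>s q = key \<pi>s q' \<Longrightarrow> key \<pi>s (c # q) = key \<pi>s (c # q')"
  by (auto simp: key_def)

lemma admissible_cong: "key \<pi>s q = key \<pi>s q' \<Longrightarrow> admissible \<pi>s c q = admissible \<pi>s c q'"
  by (auto simp: key_def admissible_def)

text \<open>The price of putting \<open>c\<close> in front depends on the tail only through its set
  of candidates, and is zero for an empty profile. This is why optimal suffixes can be built from
  optimal tails.\<close>

lemma supports_eq:
  assumes "valid \<pi>s cs q" "valid \<pi>s cs q'" "key \<pi>s q = key \<pi>s q'"
  shows "(\<Sum>d\<leftarrow>q. support \<pi>s d c) = (\<Sum>d\<leftarrow>q'. support \<pi>s d c)"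
proof (cases "\<pi>s = []")
  case True
  then show ?thesis by (simp add: support_def)
next
  case False
  then have "set q = set q'" using assms valid_subset key_eq by metis
  then show ?thesis using valid_distinct[OF assms(1)] valid_distinct[OF assms(2)]
    by (simp add: sum_list_distinct_conv_sum_set)
qed

text \<open>The principle of optimality, as a sum to avoid subtraction of naturals. For a nonempty
  profile the tails have the same set and \<open>c' = c\<close> works. For the empty profile
  \<open>c\<close> may already occur in \<open>q'\<close>; any candidate outside \<open>q'\<close>
  serves then, and one exists because \<open>q'\<close> is too short to contain all.\<close>

lemma exchange:
  assumes "valid \<pi>s cs (c # q)" "valid \<pi>s cs q'" "length q' = length q" "key \<pi>s q' = key \<pi>s q"
  shows "\<exists>c'\<in>set cs. valid \<pi>s cs (c' # q') \<and> key \<pi>s (c' # q') = key \<pi>s (c # q) \<and>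
           score \<pi>s (c' # q') + score \<pi>s q = score \<pi>s (c # q) + score \<pi>s q'"
proof (cases "\<pi>s = []")
  case True
  have "length (c # q) \<le> length cs" using assms(1) by (rule valid_length)
  then have "card (set q') < card (set cs)"
    using assms(3) distinct_cs valid_distinct[OF assms(2)] by (simp add: distinct_card)
  then obtain c' where c': "c' \<in> set cs" "c' \<notin> set q'"
    by (metis card_mono finite_set not_less subsetI)
  have "score [] p = 0" for p :: "'a list" by (induction p) (auto simp: support_def)
  then show ?thesis using True c' assms
    by (intro bexI[of _ c']) (auto simp: admissible_def first_ranking_def key_def support_def)
next
  case False
  have q: "valid \<pi>s cs q" using assms(1) by simp
  have "set q' = set q" using assms(2,4) q False valid_subset key_eq by metis
  then show ?thesis
    using assms supports_eq[OF assms(2) q assms(4), of c] admissible_cong[OF assms(4)]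
      key_Cons[OF assms(4)]
    by (intro bexI[of _ c]) auto
qed

end

section \<open>Lists of minimum-score suffixes with a cut-off\<close>

definition optimal :: "'a list list \<Rightarrow> 'a list set \<Rightarrow> 'a set \<Rightarrow> 'a list set" where
  "optimal \<pi>s F k =
     {q \<in> F. key \<pi>s q = k \<and> (\<forall>q'\<in>F. key \<pi>s q' = k \<longrightarrow> score \<pi>s q \<le> score \<pi>s q')}"

text \<open>The last conjunct is the alternative that survives the cut-off: an optimal suffix may be
  missing only from a list that has reached \<open>R\<close> members.\<close>

definition represents_class ::
    "'a list list \<Rightarrow> nat \<Rightarrow> 'a list set \<Rightarrow> 'a list list \<Rightarrow> bool" where
  "represents_class \<pi>s R F s \<longleftrightarrow>
     s \<noteq> [] \<and> distinct s \<and> length s \<le> R \<and> set s \<subseteq> optimal \<pi>s F (key \<pi>s (hd s)) \<and>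
     (R \<le> length s \<or> optimal \<pi>s F (key \<pi>s (hd s)) \<subseteq> set s)"

definition represents ::
    "'a list list \<Rightarrow> nat \<Rightarrow> 'a list list list \<Rightarrow> 'a list set \<Rightarrow> bool" where
  "represents \<pi>s R L F \<longleftrightarrow>
     distinct (map (\<lambda>s. key \<pi>s (hd s)) L) \<and> (\<forall>s\<in>set L. represents_class \<pi>s R F s) \<and>
     (\<forall>q\<in>F. \<exists>s\<in>set L. key \<pi>s (hd s) = key \<pi>s q)"

text \<open>Weaker than optimality on purpose: a list of fresh extensions has one key and one score
  before it is known how that score compares with what is already stored.\<close>

definition uniform :: "'a list list \<Rightarrow> 'a list list \<Rightarrow> bool" where
  "uniform \<pi>s b \<longleftrightarrow>
     (\<forall>q\<in>set b. \<forall>q'\<in>set b. key \<pi>s q = key \<pi>s q' \<and> score \<pi>s q = score \<pi>s q')"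

lemma optimal_eqI:
  assumes "q \<in> F" "key \<pi>s q = k" "\<And>q'. q' \<in> F \<Longrightarrow> key \<pi>s q' = k \<Longrightarrow> score \<pi>s q \<le> score \<pi>s q'"
  shows "optimal \<pi>s F k = {q' \<in> F. key \<pi>s q' = k \<and> score \<pi>s q' = score \<pi>s q}"
proof (intro set_eqI iffI)
  fix p assume "p \<in> optimal \<pi>s F k"
  then show "p \<in> {q' \<in> F. key \<pi>s q' = k \<and> score \<pi>s q' = score \<pi>s q}"
    using assms(1,2) assms(3)[of p] by (auto simp: optimal_def)
next
  fix p assume "p \<in> {q' \<in> F. key \<pi>s q' = k \<and> score \<pi>s q' = score \<pi>s q}"
  then show "p \<in> optimal \<pi>s F k" using assms(3) by (simp add: optimal_def)
qed

lemma represents_class_uniform: "represents_class \<pi>s R F s \<Longrightarrow> uniform \<pi>s s"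
proof -
  assume "represents_class \<pi>s R F s"
  then have "q \<in> optimal \<pi>s F (key \<pi>s (hd s))" if "q \<in> set s" for q
    using that by (auto simp: represents_class_def)
  then have *: "key \<pi>s q = key \<pi>s (hd s)" "score \<pi>s q \<le> score \<pi>s q'"
    if "q \<in> set s" "q' \<in> set s" for q q'
    using that unfolding optimal_def by blast+
  show ?thesis unfolding uniform_def
  proof (intro ballI conjI)
    fix q q' assume q: "q \<in> set s" "q' \<in> set s"
    show "key \<pi>s q = key \<pi>s q'" using *(1)[OF q] *(1)[OF q(2,1)] by (rule trans[OF _ sym])
    show "score \<pi>s q = score \<pi>s q'" using *(2)[OF q] *(2)[OF q(2,1)] by (rule order.antisym)
  qed
qed

lemma represents_classD:
  assumes "represents_class \<pi>s R F s" "q \<in> set s"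
  shows "q \<in> F" "key \<pi>s q = key \<pi>s (hd s)" "q \<in> optimal \<pi>s F (key \<pi>s (hd s))"
proof -
  show "q \<in> optimal \<pi>s F (key \<pi>s (hd s))"
    using assms unfolding represents_class_def by blast
  then show "q \<in> F" "key \<pi>s q = key \<pi>s (hd s)" by (simp_all add: optimal_def)
qed

lemma optimal_Un_other:
  assumes "\<forall>q\<in>B. key \<pi>s q \<noteq> k"
  shows "optimal \<pi>s (F \<union> B) k = optimal \<pi>s F k"
  using assms by (auto simp: optimal_def)

lemma represents_class_Un_other:
  assumes "represents_class \<pi>s R F s" "\<forall>q\<in>B. key \<pi>s q \<noteq> key \<pi>s (hd s)"
  shows "represents_class \<pi>s R (F \<union> B) s"
  using assms by (simp add: represents_class_def optimal_Un_other)

text \<open>\<open>F\<close> stands for everything generated so far, including what was discarded. A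
  worse \<open>b\<close> leaves the optimum of the class unchanged, a better \<open>b\<close>
  becomes the whole optimum, and in a tie the optimum is the union. \<open>fresh\<close> keeps the
  concatenation free of repetitions.\<close>

lemma represents_class_combine:
  assumes s: "represents_class \<pi>s R F s" and b: "b \<noteq> []" "distinct b" "length b \<le> R" "uniform \<pi>s b"
    and fresh: "set b \<inter> F = {}" and key: "key \<pi>s (hd s) = key \<pi>s (hd b)" and R: "R > 0"
  shows "represents_class \<pi>s R (F \<union> set b) (combine \<pi>s R s b)"
proof -
  define k where "k = key \<pi>s (hd b)"
  define m where "m = score \<pi>s (hd b)"
  have s': "s \<noteq> []" "distinct s" "length s \<le> R" "set s \<subseteq> optimal \<pi>s F k"
      "R \<le> length s \<or> optimal \<pi>s F k \<subseteq> set s"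
    using s key by (simp_all add: represents_class_def k_def)
  have hd_s: "hd s \<in> optimal \<pi>s F k" using s'(1,4) by auto
  have sF: "set s \<subseteq> F" using s'(4) by (auto simp: optimal_def)
  have b': "key \<pi>s q = k" "score \<pi>s q = m" if "q \<in> set b" for q
    using b(4) that hd_in_set[OF b(1)] unfolding uniform_def k_def m_def by blast+
  have le: "score \<pi>s (hd s) \<le> score \<pi>s q" if "q \<in> F" "key \<pi>s q = k" for q
    using hd_s that by (simp add: optimal_def)
  have hsF: "hd s \<in> F" "key \<pi>s (hd s) = k" using hd_s by (simp_all add: optimal_def)
  have optF: "optimal \<pi>s F k = {q \<in> F. key \<pi>s q = k \<and> score \<pi>s q = score \<pi>s (hd s)}"
    by (rule optimal_eqI[OF hsF le])
  consider "score \<pi>s (hd s) < m" | "m < score \<pi>s (hd s)"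
    | "score \<pi>s (hd s) = m" by linarith
  then show ?thesis
  proof cases
    case 1
    have "optimal \<pi>s (F \<union> set b) k =
        {q \<in> F \<union> set b. key \<pi>s q = k \<and> score \<pi>s q = score \<pi>s (hd s)}"
      using 1 hsF b' le by (intro optimal_eqI) auto
    also have "\<dots> = optimal \<pi>s F k" unfolding optF using 1 b'(2) by auto
    finally have "optimal \<pi>s (F \<union> set b) k = optimal \<pi>s F k" .
    then show ?thesis using 1 s' key by (simp add: combine_def represents_class_def k_def[symmetric] m_def[symmetric])
  next
    case 2
    have "optimal \<pi>s (F \<union> set b) k =
        {q \<in> F \<union> set b. key \<pi>s q = k \<and> score \<pi>s q = m}"
      unfolding m_def
    proof (rule optimal_eqI)
      show "score \<pi>s (hd b) \<le> score \<pi>s q" if "q \<in> F \<union> set b" "key \<pi>s q = k" for q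
        using that b'(2)[of q] le[of q] 2 by (auto simp: m_def[symmetric])
    qed (use b(1) in \<open>auto simp: k_def\<close>)
    also have "\<dots> = set b"
    proof (intro set_eqI iffI)
      fix q assume "q \<in> {q \<in> F \<union> set b. key \<pi>s q = k \<and> score \<pi>s q = m}"
      then show "q \<in> set b" using 2 le[of q] by auto
    qed (use b' in auto)
    finally have "optimal \<pi>s (F \<union> set b) k = set b" .
    then show ?thesis using 2 b by (simp add: combine_def represents_class_def k_def[symmetric] m_def[symmetric])
  next
    case 3
    have "optimal \<pi>s (F \<union> set b) k =
        {q \<in> F \<union> set b. key \<pi>s q = k \<and> score \<pi>s q = score \<pi>s (hd s)}"
      using 3 hsF b' le by (intro optimal_eqI) auto
    also have "\<dots> = optimal \<pi>s F k \<union> set b" unfolding optF using 3 b' by auto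
    finally have opt: "optimal \<pi>s (F \<union> set b) k = optimal \<pi>s F k \<union> set b" .
    have "distinct (s @ b)" using s'(2) b(2) fresh sF by auto
    then have "distinct (take R (s @ b))" by (rule distinct_take)
    moreover have "set (take R (s @ b)) \<subseteq> optimal \<pi>s F k \<union> set b"
      using s'(4) set_take_subset[of R "s @ b"] by auto
    \<comment> \<open>A full \<open>s\<close> fills the result by itself. Otherwise \<open>s\<close>
      contains the old optimum, and \<open>take\<close> either reaches \<open>R\<close> members or
      removes nothing.\<close>
    moreover have "R \<le> length (take R (s @ b)) \<or> optimal \<pi>s F k \<union> set b \<subseteq> set (take R (s @ b))"
      using s'(5) by auto
    moreover have "combine \<pi>s R s b = take R (s @ b)" using 3 by (simp add: combine_def m_def)
    moreover have "take R (s @ b) \<noteq> []" "hd (take R (s @ b)) = hd s" using s'(1) R by auto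
    ultimately show ?thesis using opt key by (simp add: represents_class_def k_def)
  qed
qed

lemma represents_add_state:
  assumes L: "represents \<pi>s R L F" and b: "distinct b" "length b \<le> R" "uniform \<pi>s b"
    and fresh: "set b \<inter> F = {}" and R: "R > 0"
  shows "represents \<pi>s R (add_state \<pi>s R L b) (F \<union> set b)"
proof (cases "b = []")
  case True
  then show ?thesis using L by (simp add: add_state_def)
next
  case False
  define k where "k = key \<pi>s (hd b)"
  define m where "m = score \<pi>s (hd b)"
  have kb: "key \<pi>s q = k" if "q \<in> set b" for q
    using b(3) that hd_in_set[OF False] unfolding uniform_def k_def by blast
  show ?thesis
  proof (cases rule: insert_state_cases[of L \<pi>s b R])
    case new
    \<comment> \<open>Every class met by \<open>F\<close> has a state in \<open>L\<close>, so a key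
      absent from \<open>L\<close> means that \<open>b\<close> brings the first members of its
      class.\<close>
    have none: "key \<pi>s q \<noteq> k" if "q \<in> F" for q
      using that new L unfolding k_def by (metis represents_def)
    have sb: "score \<pi>s q = m" if "q \<in> set b" for q
      using b(3) that hd_in_set[OF False] unfolding uniform_def m_def by blast
    have "optimal \<pi>s (F \<union> set b) k = {q \<in> F \<union> set b. key \<pi>s q = k \<and> score \<pi>s q = m}"
      unfolding m_def
    proof (rule optimal_eqI)
      show "score \<pi>s (hd b) \<le> score \<pi>s q" if "q \<in> F \<union> set b" "key \<pi>s q = k" for q
        using that none[of q] sb[of q] by (auto simp: m_def)
    qed (use False in \<open>auto simp: k_def\<close>)
    also have "\<dots> = set b" using none kb sb by auto
    finally have "optimal \<pi>s (F \<union> set b) (key \<pi>s (hd b)) = set b" by (simp add: k_def)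
    then have "represents_class \<pi>s R (F \<union> set b) b"
      using b False by (simp add: represents_class_def)
    moreover have "represents_class \<pi>s R (F \<union> set b) s" if "s \<in> set L" for s
      using that L new kb by (intro represents_class_Un_other) (auto simp: represents_def k_def[symmetric])
    ultimately show ?thesis using new L kb False
      by (auto simp: represents_def add_state_def k_def[symmetric])
  next
    case (old L1 s L2)
    have s: "represents_class \<pi>s R F s" using L old by (simp add: represents_def)
    note comb = represents_class_combine[OF s False b fresh old(2) R]
    have "key \<pi>s (hd (combine \<pi>s R s b)) = k" unfolding k_def
      using combine_props(4)[OF _ False old(2) R _ b(2)] s by (simp add: represents_class_def)
    moreover have "represents_class \<pi>s R (F \<union> set b) t" if t: "t \<in> set L1 \<union> set L2" for t
    proof (rule represents_class_Un_other)
      show "represents_class \<pi>s R F t" using t L old(1) by (auto simp: represents_def)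
      have "key \<pi>s (hd t) \<noteq> k" using t L old(1,2) by (auto simp: represents_def k_def)
      then show "\<forall>q\<in>set b. key \<pi>s q \<noteq> key \<pi>s (hd t)" using kb by auto
    qed
    moreover have "key \<pi>s (hd s) = k" using old(2) by (simp add: k_def)
    ultimately show ?thesis using comb old(1,3) L kb False
      by (auto simp: represents_def add_state_def)
  qed
qed

section \<open>The invariant passes from one layer to the next\<close>

context profile
begin

lemma extend_uniform:
  assumes "uniform \<pi>s s" "\<forall>q\<in>set s. valid \<pi>s cs q"
  shows "uniform \<pi>s (extend \<pi>s s c)"
proof -
  have "key \<pi>s (c # q) = key \<pi>s (c # q') \<and> score \<pi>s (c # q) = score \<pi>s (c # q')"
    if q: "q \<in> set s" "q' \<in> set s" for q q'
  proof -
    have "key \<pi>s q = key \<pi>s q'" "score \<pi>s q = score \<pi>s q'" "valid \<pi>s cs q" "valid \<pi>s cs q'"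
      using assms q unfolding uniform_def by blast+
    then show ?thesis using supports_eq[of q q' c] key_Cons[of q q' c] by simp
  qed
  moreover have "\<exists>q\<in>set s. x = c # q" if "x \<in> set (extend \<pi>s s c)" for x
    using that by (auto simp: extend_def)
  ultimately show ?thesis unfolding uniform_def by metis
qed

lemma represents_extend_all:
  assumes "represents \<pi>s R L F" "R > 0" "distinct s" "length s \<le> R" "uniform \<pi>s s"
    "\<forall>q\<in>set s. valid \<pi>s cs q" "distinct cs'" "\<forall>c\<in>set cs'. \<forall>q\<in>set s. c # q \<notin> F"
  shows "represents \<pi>s R (extend_all \<pi>s R cs' s L) (F \<union> (\<Union>c\<in>set cs'. set (extend \<pi>s s c)))"
  using assms(1,7,8)
proof (induction cs' arbitrary: L F)
  case (Cons c cs')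
  have "represents \<pi>s R (add_state \<pi>s R L (extend \<pi>s s c)) (F \<union> set (extend \<pi>s s c))"
  proof (rule represents_add_state[OF Cons.prems(1) _ _ _ _ assms(2)])
    show "distinct (extend \<pi>s s c)"
      using assms(3) by (simp add: extend_def distinct_map inj_on_def)
    show "length (extend \<pi>s s c) \<le> R"
      using assms(4) by (auto simp: extend_def intro: order.trans[OF length_filter_le])
  qed (use Cons.prems extend_uniform[OF assms(5,6)] in \<open>auto simp: extend_def\<close>)
  \<comment> \<open>Extensions by different candidates differ in their heads, so the remaining ones
    are still fresh.\<close>
  moreover have "\<forall>c'\<in>set cs'. \<forall>q\<in>set s. c' # q \<notin> F \<union> set (extend \<pi>s s c)"
    using Cons.prems by (auto simp: extend_def)
  ultimately have "represents \<pi>s R (extend_all \<pi>s R cs' s (add_state \<pi>s R L (extend \<pi>s s c)))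
      (F \<union> set (extend \<pi>s s c) \<union> (\<Union>c\<in>set cs'. set (extend \<pi>s s c)))"
    using Cons.prems(2) by (intro Cons.IH) auto
  then show ?case by (simp add: extend_all_def Un_assoc)
qed (simp add: extend_all_def)

lemma represents_next_layer:
  assumes "represents \<pi>s R L' F" "R > 0"
    "\<forall>s\<in>set L. represents_class \<pi>s R V s" "\<forall>q\<in>V. valid \<pi>s cs q"
    "distinct (map (\<lambda>s. key \<pi>s (hd s)) L)" "\<forall>s\<in>set L. \<forall>q\<in>set s. \<forall>c. c # q \<notin> F"
  shows "represents \<pi>s R (next_layer \<pi>s R cs L L')
           (F \<union> (\<Union>s\<in>set L. \<Union>c\<in>set cs. set (extend \<pi>s s c)))"
  using assms(1,3,5,6)
proof (induction L arbitrary: L' F)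
  case (Cons s L)
  let ?F = "F \<union> (\<Union>c\<in>set cs. set (extend \<pi>s s c))"
  have s: "represents_class \<pi>s R V s" using Cons.prems by simp
  have "represents \<pi>s R (extend_all \<pi>s R cs s L') ?F"
  proof (rule represents_extend_all[OF Cons.prems(1) assms(2) _ _ represents_class_uniform[OF s]])
    show "distinct s" "length s \<le> R" using s by (simp_all add: represents_class_def)
    show "\<forall>q\<in>set s. valid \<pi>s cs q" using represents_classD(1)[OF s] assms(4) by blast
    show "\<forall>c\<in>set cs. \<forall>q\<in>set s. c # q \<notin> F" using Cons.prems(4) by simp
  qed (rule distinct_cs)
  \<comment> \<open>Different states have different keys and hence share no suffix, so extensions of
    \<open>t\<close> have other tails than those of \<open>s\<close>.\<close>
  moreover have "c # q \<notin> ?F" if t: "t \<in> set L" and q: "q \<in> set t" for t q c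
  proof -
    have "represents_class \<pi>s R V t" using Cons.prems(2) t by simp
    moreover have "key \<pi>s (hd t) \<noteq> key \<pi>s (hd s)"
      using Cons.prems(3) t by (metis (mono_tags, lifting) distinct.simps(2) image_eqI list.map(2) list.set_map)
    ultimately have "q \<notin> set s" using represents_classD(2)[OF s, of q] represents_classD(2)[of \<pi>s R V t q] q
      by auto
    then show ?thesis using Cons.prems(4) t q by (auto simp: extend_def)
  qed
  ultimately have "represents \<pi>s R (next_layer \<pi>s R cs L (extend_all \<pi>s R cs s L'))
      (?F \<union> (\<Union>s\<in>set L. \<Union>c\<in>set cs. set (extend \<pi>s s c)))"
    using Cons.prems by (intro Cons.IH) auto
  then show ?case by (simp add: next_layer_def Un_assoc)
qed (simp add: next_layer_def)

text \<open>Insertion gives the invariant only relative to \<open>F\<close>, the extensions of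
  suffixes that were kept. The work lies in passing to \<open>W\<close>, all valid suffixes of this
  length: the minima must agree, and a list that is not full must lack no optimal member of
  \<open>W\<close>.\<close>

lemma represents_layer:
  assumes R: "R > 0"
  shows "represents \<pi>s R (layer \<pi>s R cs k) {q. valid \<pi>s cs q \<and> length q = k}"
proof (induction k)
  case 0
  have "{q. valid \<pi>s cs q \<and> length q = 0} = {[]}" by auto
  then show ?case using R
    by (auto simp: represents_def represents_class_def optimal_def)
next
  case (Suc k)
  define V where "V = {q. valid \<pi>s cs q \<and> length q = k}"
  define W where "W = {q. valid \<pi>s cs q \<and> length q = Suc k}"
  define L where "L = layer \<pi>s R cs k"
  define F where "F = (\<Union>s\<in>set L. \<Union>c\<in>set cs. set (extend \<pi>s s c))"
  have L: "represents \<pi>s R L V" using Suc by (simp add: L_def V_def)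
  then have state: "represents_class \<pi>s R V s" if "s \<in> set L" for s
    using that by (simp add: represents_def)
  have sV: "set s \<subseteq> V" if "s \<in> set L" for s
    using represents_classD(1)[OF state[OF that]] by auto
  have "represents \<pi>s R (next_layer \<pi>s R cs L []) ({} \<union> F)"
    unfolding F_def using L R
    by (intro represents_next_layer[where V = V]) (auto simp: represents_def V_def)
  then have rep: "represents \<pi>s R (layer \<pi>s R cs (Suc k)) F" by (simp add: L_def)
  have F_iff: "c # q \<in> F \<longleftrightarrow> valid \<pi>s cs (c # q) \<and> (\<exists>s\<in>set L. q \<in> set s)" for c q
    unfolding F_def extend_def using sV by (auto simp: V_def)
  have FW: "F \<subseteq> W"
  proof
    fix x assume "x \<in> F"
    moreover from this obtain c q where "x = c # q" by (auto simp: F_def extend_def)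
    ultimately show "x \<in> W" using F_iff[of c q] sV by (auto simp: W_def V_def)
  qed
  \<comment> \<open>The tail \<open>q\<close> of any valid suffix can be exchanged for any kept
    \<open>p\<close> of its class. As \<open>p\<close> is optimal there, the score does not
    increase.\<close>
  have dom: "\<exists>s\<in>set L. key \<pi>s (hd s) = key \<pi>s q \<and>
      (\<forall>p\<in>set s. score \<pi>s p \<le> score \<pi>s q \<and>
        (\<exists>c'. c' # p \<in> F \<and> key \<pi>s (c' # p) = key \<pi>s (c # q) \<and>
           score \<pi>s (c' # p) + score \<pi>s q = score \<pi>s (c # q) + score \<pi>s p))"
    if W: "c # q \<in> W" for c q
  proof -
    have q: "q \<in> V" using W by (simp add: W_def V_def)
    then obtain s where s: "s \<in> set L" "key \<pi>s (hd s) = key \<pi>s q"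
      using L by (auto simp: represents_def)
    have "score \<pi>s p \<le> score \<pi>s q \<and> (\<exists>c'. c' # p \<in> F \<and> key \<pi>s (c' # p) = key \<pi>s (c # q) \<and>
           score \<pi>s (c' # p) + score \<pi>s q = score \<pi>s (c # q) + score \<pi>s p)"
      if p: "p \<in> set s" for p
    proof -
      have "p \<in> optimal \<pi>s V (key \<pi>s q)"
        using represents_classD(3)[OF state[OF s(1)] p] s(2) by simp
      then have p': "p \<in> V" "key \<pi>s p = key \<pi>s q" "score \<pi>s p \<le> score \<pi>s q"
        using q by (auto simp: optimal_def)
      then obtain c' where "valid \<pi>s cs (c' # p)" "key \<pi>s (c' # p) = key \<pi>s (c # q)"
        "score \<pi>s (c' # p) + score \<pi>s q = score \<pi>s (c # q) + score \<pi>s p"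
        using exchange[of c q p] W q by (auto simp: W_def V_def)
      then show ?thesis using p'(3) p s(1) F_iff by blast
    qed
    then show ?thesis using s by blast
  qed
  have better: "\<exists>y\<in>F. key \<pi>s y = key \<pi>s x \<and> score \<pi>s y \<le> score \<pi>s x" if "x \<in> W" for x
  proof -
    obtain c q where x: "x = c # q" using \<open>x \<in> W\<close> by (cases x) (auto simp: W_def)
    then obtain s where s: "s \<in> set L" and d: "\<forall>p\<in>set s. score \<pi>s p \<le> score \<pi>s q \<and>
        (\<exists>c'. c' # p \<in> F \<and> key \<pi>s (c' # p) = key \<pi>s (c # q) \<and>
           score \<pi>s (c' # p) + score \<pi>s q = score \<pi>s (c # q) + score \<pi>s p)"
      using dom[of c q] \<open>x \<in> W\<close> by auto
    have "hd s \<in> set s" using state[OF s] by (auto simp: represents_class_def)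
    with d obtain c' where "score \<pi>s (hd s) \<le> score \<pi>s q" "c' # hd s \<in> F"
      "key \<pi>s (c' # hd s) = key \<pi>s (c # q)"
      "score \<pi>s (c' # hd s) + score \<pi>s q = score \<pi>s (c # q) + score \<pi>s (hd s)"
      by blast
    then show ?thesis using x by (intro bexI[of _ "c' # hd s"]) auto
  qed
  have opt_sub: "optimal \<pi>s F a \<subseteq> optimal \<pi>s W a" for a
  proof
    fix y assume y: "y \<in> optimal \<pi>s F a"
    have "score \<pi>s y \<le> score \<pi>s x" if x: "x \<in> W" "key \<pi>s x = a" for x
    proof -
      obtain y' where "y' \<in> F" "key \<pi>s y' = a" "score \<pi>s y' \<le> score \<pi>s x"
        using better[OF x(1)] x(2) by auto
      moreover from this have "score \<pi>s y \<le> score \<pi>s y'" using y by (simp add: optimal_def)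
      ultimately show ?thesis by linarith
    qed
    then show "y \<in> optimal \<pi>s W a" using y FW by (auto simp: optimal_def)
  qed
  have full: "R \<le> length t \<or> optimal \<pi>s W (key \<pi>s (hd t)) \<subseteq> set t"
    if t: "t \<in> set (layer \<pi>s R cs (Suc k))" for t
  proof (rule ccontr)
    assume neg: "\<not> ?thesis"
    let ?a = "key \<pi>s (hd t)"
    have t': "optimal \<pi>s F ?a \<subseteq> set t"
      using neg rep t by (auto simp: represents_def represents_class_def)
    obtain x where x: "x \<in> optimal \<pi>s W ?a" "x \<notin> set t" using neg by auto
    then have xW: "x \<in> W" "key \<pi>s x = ?a" by (auto simp: optimal_def)
    then obtain c q where cq: "x = c # q" by (cases x) (auto simp: W_def)
    obtain s where s: "s \<in> set L" "key \<pi>s (hd s) = key \<pi>s q" and d: "\<And>p. p \<in> set s \<Longrightarrow>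
        score \<pi>s p \<le> score \<pi>s q \<and> (\<exists>c'. c' # p \<in> F \<and> key \<pi>s (c' # p) = key \<pi>s (c # q) \<and>
           score \<pi>s (c' # p) + score \<pi>s q = score \<pi>s (c # q) + score \<pi>s p)"
      using dom[of c q] xW cq by blast
    have x_min: "score \<pi>s x \<le> score \<pi>s z" if "z \<in> F" "key \<pi>s z = ?a" for z
      using x(1) that FW by (auto simp: optimal_def)
    \<comment> \<open>A member of \<open>F\<close> in the class of \<open>x\<close> that is no worse
      than \<open>x\<close> is itself minimal, hence contained in \<open>t\<close>, which is assumed
      not to be full.\<close>
    have opt: "y \<in> set t \<and> score \<pi>s y = score \<pi>s x"
      if y: "y \<in> F" "key \<pi>s y = ?a" "score \<pi>s y \<le> score \<pi>s x" for y
    proof -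
      have "\<forall>z\<in>F. key \<pi>s z = ?a \<longrightarrow> score \<pi>s y \<le> score \<pi>s z"
        using x_min y(3) order.trans by blast
      then have "y \<in> optimal \<pi>s F ?a" using y by (simp add: optimal_def)
      then show ?thesis using t' x_min[OF y(1,2)] y(3) by auto
    qed
    \<comment> \<open>The exchanged suffix has exactly the score of \<open>x\<close>, and the
      exchange equation then forces \<open>p\<close> and \<open>q\<close> to have equal scores. So
      \<open>q\<close> is optimal too, and its absence from \<open>s\<close> means that
      \<open>s\<close> is full.\<close>
    have img: "\<exists>c'. c' # p \<in> set t \<and> score \<pi>s p = score \<pi>s q" if p: "p \<in> set s" for p
    proof -
      obtain c' where c': "score \<pi>s p \<le> score \<pi>s q" "c' # p \<in> F" "key \<pi>s (c' # p) = ?a"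
        "score \<pi>s (c' # p) + score \<pi>s q = score \<pi>s x + score \<pi>s p"
        using d[OF p] cq xW by auto
      then have "c' # p \<in> set t \<and> score \<pi>s (c' # p) = score \<pi>s x" by (intro opt) auto
      then show ?thesis using c' by auto
    qed
    have "q \<notin> set s"
    proof
      assume "q \<in> set s"
      then have "x \<in> F" using F_iff[of c q] s(1) xW(1) cq by (auto simp: W_def)
      then show False using opt[of x] xW(2) x(2) by simp
    qed
    moreover have "q \<in> optimal \<pi>s V (key \<pi>s q)"
    proof -
      have hd_s: "hd s \<in> set s" using state[OF s(1)] by (simp add: represents_class_def)
      have "hd s \<in> optimal \<pi>s V (key \<pi>s q)"
        using represents_classD(3)[OF state[OF s(1)] hd_s] s(2) by simp
      moreover have "score \<pi>s (hd s) = score \<pi>s q" using img[OF hd_s] by auto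
      moreover have "q \<in> V" using xW cq by (simp add: W_def V_def)
      ultimately show ?thesis by (simp add: optimal_def)
    qed
    moreover have "R \<le> length s \<or> optimal \<pi>s V (key \<pi>s q) \<subseteq> set s"
      using state[OF s(1)] by (simp add: represents_class_def s(2))
    ultimately have "R \<le> length s" by blast
    also have "length s = card (set s)"
      using state[OF s(1)] by (auto simp: represents_class_def distinct_card)
    \<comment> \<open>Removing heads recovers every member of the full list \<open>s\<close> from
      \<open>t\<close>, so \<open>t\<close> is full, a contradiction.\<close>
    also have "\<dots> \<le> card (tl ` set t)"
    proof (intro card_mono subsetI)
      fix p assume "p \<in> set s"
      then obtain c' where "c' # p \<in> set t" using img by blast
      then show "p \<in> tl ` set t" by (rule image_eqI[rotated]) simp
    qed simp
    also have "\<dots> \<le> length t" using card_image_le[of "set t" tl] card_length[of t] by simp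
    finally show False using neg by simp
  qed
  have "represents_class \<pi>s R W t" if t: "t \<in> set (layer \<pi>s R cs (Suc k))" for t
  proof -
    have "represents_class \<pi>s R F t" using rep t by (simp only: represents_def)
    then show ?thesis
      using full[OF t] opt_sub[of "key \<pi>s (hd t)"] by (auto simp only: represents_class_def)
  qed
  moreover have "\<exists>t\<in>set (layer \<pi>s R cs (Suc k)). key \<pi>s (hd t) = key \<pi>s x" if x: "x \<in> W" for x
  proof -
    obtain y where y: "y \<in> F" "key \<pi>s y = key \<pi>s x" using better[OF x] by blast
    then show ?thesis using rep unfolding represents_def y(2)[symmetric] by blast
  qed
  moreover have "distinct (map (\<lambda>s. key \<pi>s (hd s)) (layer \<pi>s R cs (Suc k)))"
    using rep by (simp only: represents_def)
  ultimately show ?case unfolding represents_def W_def by blast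
qed

end

section \<open>Counting upsets\<close>

lemma cliques_in_path_decomposition:
  assumes B: "path_decomposition V E B" and fin: "finite V"
    and width: "\<And>X. X \<in> set B \<Longrightarrow> card X \<le> b"
    and cliques: "\<And>K. K \<in> \<K> \<Longrightarrow> K \<subseteq> V \<and> (\<forall>u\<in>K. \<forall>v\<in>K. u \<noteq> v \<longrightarrow> {u, v} \<in> E)"
  shows "card \<K> \<le> card V * 2 ^ b + 1"
proof -
  define first where "first v = (LEAST i. i < length B \<and> v \<in> B ! i)" for v
  have UB: "\<Union>(set B) = V" and edges: "\<And>e. e \<in> E \<Longrightarrow> \<exists>X\<in>set B. e \<subseteq> X"
    and between: "\<And>i j k. i \<le> j \<Longrightarrow> j \<le> k \<Longrightarrow> k < length B \<Longrightarrow> B ! i \<inter> B ! k \<subseteq> B ! j"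
    using B unfolding path_decomposition_def by blast+
  have first: "first v < length B \<and> v \<in> B ! first v" if "v \<in> V" for v
  proof -
    obtain i where "i < length B \<and> v \<in> B ! i" using \<open>v \<in> V\<close> UB by (metis UnionE in_set_conv_nth)
    then show ?thesis unfolding first_def by (rule LeastI)
  qed
  have first_le: "first v \<le> i" if "i < length B" "v \<in> B ! i" for v i
    unfolding first_def using that by (intro Least_le) simp
  have bag: "B ! first v \<in> set B" if "v \<in> V" for v using first[OF that] by simp
  \<comment> \<open>The empty clique has no last vertex and is counted separately; it is the
    \<open>+ 1\<close> of the bound.\<close>
  have "\<K> - {{}} \<subseteq> (\<Union>v\<in>V. Pow (B ! first v))"
  proof
    fix K assume K: "K \<in> \<K> - {{}}"
    then have KV: "K \<subseteq> V" "K \<noteq> {}" using cliques[of K] by simp_all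
    have finK: "finite K" using finite_subset[OF KV(1) fin] .
    obtain v where v: "v \<in> K" "\<And>u. u \<in> K \<Longrightarrow> first u \<le> first v"
    proof -
      have "Max (first ` K) \<in> first ` K" using KV(2) finK by (intro Max_in) auto
      then obtain v where "v \<in> K" "first v = Max (first ` K)" by force
      then show ?thesis using finK by (intro that[of v]) auto
    qed
    have "u \<in> B ! first v" if u: "u \<in> K" for u
    proof (cases "u = v")
      case True
      then show ?thesis using first[of v] v(1) KV(1) by auto
    next
      case False
      then have "{u, v} \<in> E" using cliques[of K] K u v(1) by simp
      then obtain X where X: "X \<in> set B" "u \<in> X" "v \<in> X" using edges[of "{u, v}"] by auto
      then obtain j where j: "j < length B" "B ! j = X" by (auto simp: in_set_conv_nth)
      \<comment> \<open>The bag \<open>j\<close> contains the edge, so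
        \<open>first u \<le> first v \<le> j\<close>; as \<open>u\<close> lies in both outer bags,
        it lies in the middle one.\<close>
      have "B ! first u \<inter> B ! j \<subseteq> B ! first v"
        using j X by (intro between v(2)[OF u] first_le) simp_all
      moreover have "u \<in> B ! first u" using first[of u] u KV(1) by auto
      ultimately show ?thesis using X j by auto
    qed
    then show "K \<in> (\<Union>v\<in>V. Pow (B ! first v))" using v(1) KV(1) by auto
  qed
  moreover have finB: "finite (B ! first v)" if "v \<in> V" for v
    using bag[OF that] UB fin by (metis Union_upper finite_subset)
  ultimately have "card (\<K> - {{}}) \<le> card (\<Union>v\<in>V. Pow (B ! first v))"
    using fin by (intro card_mono) auto
  also have "\<dots> \<le> (\<Sum>v\<in>V. card (Pow (B ! first v)))" by (rule card_UN_le[OF fin])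
  also have "\<dots> \<le> (\<Sum>v\<in>V. 2 ^ b)"
    using width[OF bag] finB by (intro sum_mono) (simp add: card_Pow)
  finally have "card (\<K> - {{}}) \<le> card V * 2 ^ b" by simp
  moreover have "card \<K> \<le> card (\<K> - {{}}) + 1"
    by (auto simp: card_Diff_singleton_if)
  ultimately show ?thesis by linarith
qed

text \<open>The decomposition with the single bag \<open>V\<close> makes the \<open>LEAST\<close>
  range over a nonempty set. The bound on the bags is immune to the truncated subtraction in
  \<open>decomposition_width\<close>.\<close>

lemma pathwidth_attained:
  assumes "finite V" "\<And>e. e \<in> E \<Longrightarrow> e \<subseteq> V"
  shows "\<exists>B. path_decomposition V E B \<and> (\<forall>X\<in>set B. card X \<le> pathwidth V E + 1)"
proof -
  have "path_decomposition V E [V]" using assms by (auto simp: path_decomposition_def)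
  then have "\<exists>B. path_decomposition V E B \<and> decomposition_width B = pathwidth V E"
    unfolding pathwidth_def
    by (intro LeastI_ex[of "\<lambda>w. \<exists>B. path_decomposition V E B \<and> decomposition_width B = w"]) auto
  then obtain B where B: "path_decomposition V E B" "decomposition_width B = pathwidth V E" by blast
  have "card X \<le> pathwidth V E + 1" if "X \<in> set B" for X
  proof -
    have "card X \<le> Max (card ` set B)" using that by (intro Max_ge) auto
    then show ?thesis using B(2) by (simp add: decomposition_width_def)
  qed
  with B show ?thesis by blast
qed

section \<open>Upsets of the unanimity order and the number of states\<close>

context profile
begin

abbreviation "C \<equiv> set cs"
abbreviation "\<rho> \<equiv> unanimity_order C (mset \<pi>s)"

lemma unanimity_iff:
  "(a, d) \<in> \<rho> \<longleftrightarrow> a \<in> C \<and> d \<in> C \<and> (\<forall>\<pi>\<in>set \<pi>s. prefers \<pi> a d)"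
  by (auto simp: unanimity_order_def)

lemma unanimity_order_strict:
  assumes "\<pi>s \<noteq> []"
  shows "trans \<rho>" "irrefl \<rho>"
proof -
  obtain \<pi> where \<pi>: "\<pi> \<in> set \<pi>s" using assms by (cases \<pi>s) auto
  have "\<not> prefers \<pi> a a" for a using rankings[OF \<pi>] prefers_antisym[of \<pi> a a] by auto
  then show "irrefl \<rho>" using \<pi> by (auto simp: irrefl_def unanimity_iff)
  show "trans \<rho>"
  proof (rule transI)
    fix a b c assume "(a, b) \<in> \<rho>" "(b, c) \<in> \<rho>"
    then have "prefers \<pi> a c" if "\<pi> \<in> set \<pi>s" for \<pi>
      using that rankings[OF that] prefers_trans[of \<pi> a b c] by (simp add: unanimity_iff)
    then show "(a, c) \<in> \<rho>"
      using \<open>(a, b) \<in> \<rho>\<close> \<open>(b, c) \<in> \<rho>\<close> by (simp add: unanimity_iff)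
  qed
qed

lemma card_upsets:
  assumes "\<pi>s \<noteq> []"
  shows "card {U. U \<subseteq> C \<and> (\<forall>a\<in>U. \<forall>d. (a, d) \<in> \<rho> \<longrightarrow> d \<in> U)}
           \<le> length cs * 2 ^ (unanimity_width C (mset \<pi>s) + 1) + 1"
proof -
  let ?U = "{U. U \<subseteq> C \<and> (\<forall>a\<in>U. \<forall>d. (a, d) \<in> \<rho> \<longrightarrow> d \<in> U)}"
  define M where "M U = {u \<in> U. \<forall>x\<in>U. (x, u) \<notin> \<rho>}" for U
  have "\<rho> \<subseteq> C \<times> C" by (auto simp: unanimity_order_def)
  then have "finite \<rho>" by (rule finite_subset) simp
  moreover have "acyclic \<rho>"
    using unanimity_order_strict[OF assms] by (simp add: acyclic_irrefl)
  ultimately have wf: "wf \<rho>" by (rule finite_acyclic_wf)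
  \<comment> \<open>An upset is recovered from its minimal elements because each of its members lies
    above one. Transitivity turns a minimum among the elements below \<open>u\<close> into a minimal
    element of \<open>U\<close>.\<close>
  have below: "\<exists>m\<in>M U. m = u \<or> (m, u) \<in> \<rho>" if u: "u \<in> U" for u U
  proof -
    obtain m where m: "m \<in> {x \<in> U. x = u \<or> (x, u) \<in> \<rho>}"
      "\<And>y. (y, m) \<in> \<rho> \<Longrightarrow> y \<notin> {x \<in> U. x = u \<or> (x, u) \<in> \<rho>}"
      using wfE_min[OF wf, of u "{x \<in> U. x = u \<or> (x, u) \<in> \<rho>}"] u by blast
    then have "m \<in> M U"
      using unanimity_order_strict(1)[OF assms] unfolding M_def by (blast dest: transD)
    with m show ?thesis by blast
  qed
  have "inj_on M ?U"
  proof (rule inj_onI)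
    have sub: "U \<subseteq> W" if W: "W \<in> ?U" and M: "M U = M W" for U W
    proof
      fix u assume "u \<in> U"
      then obtain m where "m \<in> M W" "m = u \<or> (m, u) \<in> \<rho>" using below M by metis
      then show "u \<in> W" using W by (auto simp: M_def)
    qed
    fix U W assume "U \<in> ?U" "W \<in> ?U" "M U = M W"
    then show "U = W" using sub[of W U] sub[of U W] by blast
  qed
  then have "card ?U = card (M ` ?U)" by (simp add: card_image)
  obtain B where B: "path_decomposition C (cocomparability_edges C \<rho>) B"
    "\<forall>X\<in>set B. card X \<le> unanimity_width C (mset \<pi>s) + 1"
    using pathwidth_attained[of C "cocomparability_edges C \<rho>"]
    unfolding unanimity_width_def by (auto simp: cocomparability_edges_def)
  have "card (M ` ?U) \<le> card C * 2 ^ (unanimity_width C (mset \<pi>s) + 1) + 1"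
  proof (rule cliques_in_path_decomposition[OF B(1)])
    show "K \<subseteq> C \<and> (\<forall>u\<in>K. \<forall>v\<in>K. u \<noteq> v \<longrightarrow> {u, v} \<in> cocomparability_edges C \<rho>)"
      if "K \<in> M ` ?U" for K
      using that unfolding M_def cocomparability_edges_def by blast
  qed (use B(2) in auto)
  also have "card C = length cs" using distinct_cs by (rule distinct_card)
  finally show ?thesis using \<open>card ?U = card (M ` ?U)\<close> by simp
qed

text \<open>Admissibility secured the closure under what \<open>c\<close> beats at the moment
  \<open>c\<close> was put in front; later candidates only enlarge the suffix.\<close>

lemma valid_upset:
  assumes "\<pi>s \<noteq> []" "valid \<pi>s cs q" "a \<in> set q" "(a, d) \<in> \<rho>"
  shows "d \<in> set q"
  using assms(2,3)
proof (induction q)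
  case (Cons c q)
  show ?case
  proof (cases "a = c")
    case True
    have "d \<in> set (first_ranking \<pi>s)"
      using assms(1,4) by (simp add: set_first_ranking unanimity_iff)
    moreover have "\<not> prefers \<pi> d c" if "\<pi> \<in> set \<pi>s" for \<pi>
      using assms(4) that True rankings[OF that] prefers_antisym[of \<pi> c d] by (simp add: unanimity_iff)
    ultimately show ?thesis using Cons.prems(1) by (auto simp: admissible_def)
  qed (use Cons in auto)
qed simp

text \<open>This is where the width bounds the running time: the keys of a layer are distinct
  upsets. With an empty profile the only key is \<open>{}\<close>, and the summand 1 already covers
  the single state.\<close>

lemma well_formed_length:
  assumes "well_formed \<pi>s cs R L"
  shows "length L \<le> length cs * 2 ^ (unanimity_width C (mset \<pi>s) + 1) + 1"
proof -
  let ?keys = "set (map (\<lambda>s. key \<pi>s (hd s)) L)"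
  have len: "length L = card ?keys"
    using assms distinct_card[of "map (\<lambda>s. key \<pi>s (hd s)) L"] by (simp add: well_formed_def)
  have hd_valid: "valid \<pi>s cs (hd s)" if "s \<in> set L" for s
    using assms that by (simp add: well_formed_def)
  show ?thesis
  proof (cases "\<pi>s = []")
    case True
    then have "?keys \<subseteq> {{}}" by (auto simp: key_def first_ranking_def)
    then have "card ?keys \<le> 1" using card_mono[of "{{}}" ?keys] by simp
    then show ?thesis using len by linarith
  next
    case False
    have "?keys \<subseteq> {U. U \<subseteq> C \<and> (\<forall>a\<in>U. \<forall>d. (a, d) \<in> \<rho> \<longrightarrow> d \<in> U)}"
    proof
      fix U assume "U \<in> ?keys"
      then obtain s where s: "s \<in> set L" "U = key \<pi>s (hd s)" by auto
      note v = hd_valid[OF s(1)]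
      have "U = set (hd s)" using s(2) key_eq[OF valid_subset[OF v]] False by simp
      then show "U \<in> {U. U \<subseteq> C \<and> (\<forall>a\<in>U. \<forall>d. (a, d) \<in> \<rho> \<longrightarrow> d \<in> U)}"
        using valid_subset[OF v] valid_upset[OF False v] by blast
    qed
    then have "card ?keys \<le> card {U. U \<subseteq> C \<and> (\<forall>a\<in>U. \<forall>d. (a, d) \<in> \<rho> \<longrightarrow> d \<in> U)}"
      by (intro card_mono) auto
    then show ?thesis using card_upsets[OF False] len by linarith
  qed
qed

section \<open>The last layer and the Kemeny rankings\<close>

abbreviation "kemeny \<equiv> kemeny_rankings C (mset \<pi>s)"

lemma kemeny_iff:
  "Q \<in> kemeny \<longleftrightarrow> Q \<in> permutations_of_set C \<and>
     (\<forall>Q'\<in>permutations_of_set C. score \<pi>s Q \<le> score \<pi>s Q')"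
  unfolding kemeny_rankings_def by (auto simp: kemeny_score_eq permutations_of_setD)

lemma kemeny_valid:
  assumes Q: "Q \<in> kemeny"
  shows "valid \<pi>s cs Q"
proof -
  have perm: "set Q = C" "distinct Q"
    using Q by (auto simp: kemeny_iff permutations_of_setD)
  \<comment> \<open>A failure of admissibility produces a \<open>d\<close> standing before
    \<open>c\<close> although every ranking prefers \<open>c\<close>, because rankings are total;
    exchanging the two would lower the score.\<close>
  have adm: "admissible \<pi>s c q" if split: "Q = xs @ c # q" for xs c q
  proof (rule ccontr)
    assume "\<not> admissible \<pi>s c q"
    then obtain d where d: "d \<in> set (first_ranking \<pi>s)" "d \<notin> set (c # q)"
      "\<And>\<pi>. \<pi> \<in> set \<pi>s \<Longrightarrow> \<not> prefers \<pi> d c" by (auto simp: admissible_def)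
    have ne: "\<pi>s \<noteq> []" using d(1) by (auto simp: first_ranking_def)
    have "d \<in> C" using d(1) ne by (simp add: set_first_ranking)
    then have "d \<in> set xs" using perm(1) split d(2) by auto
    then obtain xs1 ys where xs: "xs = xs1 @ d # ys" by (meson split_list)
    have "distinct \<pi> \<and> prefers \<pi> c d" if "\<pi> \<in> set \<pi>s" for \<pi>
      using rankings[OF that] prefers_total[of c \<pi> d] d(2) d(3)[OF that] \<open>d \<in> C\<close> perm(1) split
      by auto
    note less = score_swap_less[OF ne this, of xs1 ys q]
    have "xs1 @ c # ys @ d # q \<in> permutations_of_set C"
      using perm split xs by (intro permutations_of_setI) auto
    then have "score \<pi>s Q \<le> score \<pi>s (xs1 @ c # ys @ d # q)" using Q by (simp add: kemeny_iff)
    with less show False using split xs by simp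
  qed
  have "valid \<pi>s cs q" if "Q = xs @ q" for xs q
    using that
  proof (induction q arbitrary: xs)
    case (Cons c q)
    then show ?case using adm[OF Cons.prems] Cons.IH[of "xs @ [c]"] perm by auto
  qed simp
  then show ?thesis by simp
qed

lemma kemeny_nonempty: "kemeny \<noteq> {}"
proof -
  have "finite (permutations_of_set C)" "permutations_of_set C \<noteq> {}" by simp_all
  then obtain Q where "Q \<in> permutations_of_set C"
    "\<forall>Q'\<in>permutations_of_set C. score \<pi>s Q \<le> score \<pi>s Q'"
    using ex_min_if_finite[of "score \<pi>s ` permutations_of_set C"] by fastforce
  then show ?thesis using kemeny_iff by blast
qed

text \<open>Valid suffixes of full length are permutations of the same set and share one key, so the
  last layer consists of one state, and "full or complete" becomes the minimum in the claim.\<close>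

lemma final_layer:
  assumes "R > 0"
  shows "\<exists>s. layer \<pi>s R cs (length cs) = [s] \<and> distinct s \<and> set s \<subseteq> kemeny \<and>
           length s = min R (card kemeny)"
proof -
  define F where "F = {q. valid \<pi>s cs q \<and> length q = length cs}"
  define L where "L = layer \<pi>s R cs (length cs)"
  have rep: "represents \<pi>s R L F" using represents_layer[OF assms] by (simp add: L_def F_def)
  have F_perm: "q \<in> permutations_of_set C" if "q \<in> F" for q
  proof -
    have q: "distinct q" "set q \<subseteq> C" "length q = length cs"
      using that valid_distinct[of \<pi>s cs q] valid_subset[of \<pi>s cs q] by (simp_all add: F_def)
    then have "card (set q) = card C" using distinct_cs by (simp add: distinct_card)
    then have "set q = C" using q(2) by (intro card_subset_eq) simp_all
    with q show ?thesis by (intro permutations_of_setI) auto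
  qed
  have kemeny_F: "kemeny \<subseteq> F"
  proof
    fix q assume q: "q \<in> kemeny"
    then have "set q = C" "distinct q" by (simp_all add: kemeny_iff permutations_of_set_def)
    then have "length q = length cs" using distinct_cs by (metis distinct_card)
    then show "q \<in> F" using kemeny_valid[OF q] by (simp add: F_def)
  qed
  have keys: "key \<pi>s q = key \<pi>s cs" if "q \<in> F" for q
    using permutations_of_setD(1)[OF F_perm[OF that]] by (simp add: key_def)
  \<comment> \<open>\<open>F\<close> need not contain all permutations, but it contains a Kemeny
    ranking, so minimizing over \<open>F\<close> and over all permutations gives the same
    value.\<close>
  have opt: "optimal \<pi>s F (key \<pi>s cs) = kemeny"
  proof (intro equalityI subsetI)
    fix q assume q: "q \<in> kemeny"
    then have "q \<in> F" using kemeny_F by blast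
    moreover have "score \<pi>s q \<le> score \<pi>s q'" if "q' \<in> F" for q'
      using q F_perm[OF that] by (simp add: kemeny_iff)
    ultimately show "q \<in> optimal \<pi>s F (key \<pi>s cs)" using keys[of q] by (simp add: optimal_def)
  next
    fix q assume q: "q \<in> optimal \<pi>s F (key \<pi>s cs)"
    obtain Q where Q: "Q \<in> kemeny" using kemeny_nonempty by blast
    then have "Q \<in> F" using kemeny_F by blast
    then have "score \<pi>s q \<le> score \<pi>s Q" using q keys[of Q] by (simp add: optimal_def)
    moreover have "q \<in> permutations_of_set C" using q F_perm by (simp add: optimal_def)
    moreover have "score \<pi>s Q \<le> score \<pi>s Q'" if "Q' \<in> permutations_of_set C" for Q'
      using Q that by (simp add: kemeny_iff)
    ultimately show "q \<in> kemeny" unfolding kemeny_iff using order.trans by blast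
  qed
  have L_keys: "key \<pi>s (hd s) = key \<pi>s cs" if "s \<in> set L" for s
  proof -
    have s: "represents_class \<pi>s R F s" using rep that unfolding represents_def by blast
    then have "hd s \<in> set s" by (simp add: represents_class_def)
    then have "hd s \<in> F" by (rule represents_classD(1)[OF s])
    then show ?thesis by (rule keys)
  qed
  have "L \<noteq> []" 
  proof -
    obtain Q where "Q \<in> F" using kemeny_nonempty kemeny_F by blast
    then have "\<exists>s\<in>set L. key \<pi>s (hd s) = key \<pi>s Q" using rep unfolding represents_def by blast
    then show ?thesis by auto
  qed
  then obtain s L' where L: "L = s # L'" by (cases L) auto
  have "L' = []"
  proof (cases L')
    case (Cons t L'')
    have "distinct (map (\<lambda>s. key \<pi>s (hd s)) (s # t # L''))"
      using rep unfolding represents_def L Cons by blast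
    moreover have "key \<pi>s (hd s) = key \<pi>s cs" "key \<pi>s (hd t) = key \<pi>s cs"
      using L Cons by (auto intro!: L_keys)
    ultimately show ?thesis by simp
  qed
  with L have Ls: "L = [s]" by simp
  have s: "distinct s" "length s \<le> R" "set s \<subseteq> kemeny" "R \<le> length s \<or> kemeny \<subseteq> set s"
  proof -
    have "represents_class \<pi>s R F s" using rep Ls by (simp add: represents_def)
    moreover have "key \<pi>s (hd s) = key \<pi>s cs" using L_keys[of s] Ls by simp
    ultimately show "distinct s" "length s \<le> R" "set s \<subseteq> kemeny" "R \<le> length s \<or> kemeny \<subseteq> set s"
      using opt by (simp_all add: represents_class_def)
  qed
  have fin: "finite kemeny" by (rule finite_subset[of _ "permutations_of_set C"]) (auto simp: kemeny_iff)
  have "length s = card (set s)" using s(1) by (simp add: distinct_card)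
  then have "length s \<le> card kemeny" "kemeny \<subseteq> set s \<Longrightarrow> card kemeny \<le> length s"
    using card_mono[OF fin s(3)] card_mono[of "set s" kemeny] by simp_all
  then have "length s = min R (card kemeny)" using s(2,4) by linarith
  then show ?thesis using Ls s unfolding L_def by (intro exI[of _ s]) simp
qed

end

section \<open>The main theorem\<close>

definition polynomial_fun :: "(nat \<Rightarrow> nat) \<Rightarrow> bool" where
  "polynomial_fun f \<longleftrightarrow> (\<exists>p. \<forall>x. poly p x = f x)"

lemma polynomial_fun_const: "polynomial_fun (\<lambda>_. c)"
  unfolding polynomial_fun_def by (rule exI[of _ "[:c:]"]) simp

lemma polynomial_fun_id: "polynomial_fun (\<lambda>x. x)"
  unfolding polynomial_fun_def by (rule exI[of _ "[:0, 1:]"]) simp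

lemma polynomial_fun_add:
  "polynomial_fun f \<Longrightarrow> polynomial_fun g \<Longrightarrow> polynomial_fun (\<lambda>x. f x + g x)"
  unfolding polynomial_fun_def by (metis poly_add)

lemma polynomial_fun_mult:
  "polynomial_fun f \<Longrightarrow> polynomial_fun g \<Longrightarrow> polynomial_fun (\<lambda>x. f x * g x)"
  unfolding polynomial_fun_def by (metis poly_mult)

lemma polynomial_fun_Suc: "polynomial_fun f \<Longrightarrow> polynomial_fun (\<lambda>x. Suc (f x))"
  using polynomial_fun_add[OF _ polynomial_fun_const[of 1], of f] by simp

lemma input_size_enc_list:
  "length l < input_size (enc_list f l)" "x \<in> set l \<Longrightarrow> input_size (f x) \<le> input_size (enc_list f l)"
  by (induction l) auto

text \<open>The square comes from \<open>N \<le> (2 * Z + 1) * 2 ^ w\<close> applied twice, the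
  factor 2 from \<open>R \<le> 2 * max 1 r\<close>, and 320 covers converting \<open>r\<close>, the
  last cut to \<open>r\<close> rankings and the main body.\<close>

definition t_main :: "nat \<Rightarrow> nat" where
  "t_main Z = 2 * ((2 * Z + 1) * (2 * Z + 1)) * (t_iterate Z + 320)"

lemma polynomial_fun_t_main: "polynomial_fun t_main"
  unfolding t_main_def t_iterate_def t_next_layer_def t_extend_all_def t_extend_def t_insert_def
    t_combine_def t_same_def t_leq_def t_score_def t_supports_def t_admissible_def t_support_def
    t_prefers_def t_member_def
  by (intro polynomial_fun_add polynomial_fun_mult polynomial_fun_Suc polynomial_fun_const
      polynomial_fun_id)

lemma compute_main:
  assumes "profile cs \<pi>s" and x: "x = enc_instance cs \<pi>s r"
  shows "\<exists>out. prog_computes 0 [x] (enc_rankings out)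
             (2 ^ (2 * unanimity_width (set cs) (mset \<pi>s)) * max 1 r * t_main (input_size x)) \<and>
           distinct_opt_kemeny_solution (set cs) (mset \<pi>s) r out"
proof -
  interpret profile cs \<pi>s by fact
  define Z where "Z = input_size x"
  define w where "w = unanimity_width (set cs) (mset \<pi>s)"
  define N where "N = length cs * 2 ^ (w + 1) + 1"
  define R where "R = Suc r"
  have sizes: "input_size (enc_nats cs) \<le> Z" "input_size (enc_rankings \<pi>s) \<le> Z"
    by (simp_all add: Z_def x enc_instance_def)
  have cs: "small Z cs"
    using input_size_enc_list(1)[of cs enc_nat] input_size_enc_list(2)[of _ cs enc_nat] sizes(1)
    unfolding small_def by (meson le_trans less_imp_le)
  have \<pi>: "small Z \<pi>" if "\<pi> \<in> set \<pi>s" for \<pi>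
  proof -
    have "input_size (enc_nats \<pi>) \<le> Z"
      using input_size_enc_list(2)[OF that, of enc_nats] sizes(2) by (simp add: enc_rankings_def)
    then show ?thesis
      using input_size_enc_list(1)[of \<pi> enc_nat] input_size_enc_list(2)[of _ \<pi> enc_nat]
      unfolding small_def by (meson le_trans less_imp_le)
  qed
  have \<pi>s: "length \<pi>s \<le> Z" "\<forall>\<pi>\<in>set \<pi>s. small Z \<pi>"
    using input_size_enc_list(1)[of \<pi>s enc_nats] sizes(2) \<pi> by (auto simp: enc_rankings_def)
  have pos: "R > 0" "N > 0" by (simp_all add: R_def N_def)
  have few: "length L \<le> N" if "well_formed \<pi>s cs R L" for L
    using well_formed_length[OF that] by (simp add: N_def w_def)
  obtain s where s: "layer \<pi>s R cs (length cs) = [s]" "distinct s" "set s \<subseteq> kemeny"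
    "length s = min R (card kemeny)" using final_layer[OF pos(1)] by blast
  define out where "out = take r s"
  have "distinct out" "set out \<subseteq> kemeny" "length out = min r (card kemeny)"
    using s(2-4) set_take_subset[of r s] by (auto simp: out_def R_def)
  then have sol: "distinct_opt_kemeny_solution (set cs) (mset \<pi>s) r out"
    by (simp add: distinct_opt_kemeny_solution_def)
  note facts = computesD[OF compute_unary[of r]]
    computesD[OF compute_iterate[OF \<pi>s cs few pos]]
    computesD[OF compute_take[of r enc_nats s, folded enc_rankings_def]]
  have bound: "200 * r + 20 + N * N * R * t_iterate Z + 20 * Suc r + 60
      \<le> 2 ^ (2 * w) * max 1 r * t_main Z"
  proof -
    have "length cs \<le> Z" using cs by (simp add: small_def)
    \<comment> \<open>Raising the summand 1 to \<open>2 ^ w\<close> makes the bound on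
      \<open>N\<close> a multiple of \<open>2 ^ w\<close>.\<close>
    then have "length cs * 2 ^ (w + 1) + 1 \<le> Z * 2 ^ (w + 1) + 2 ^ w"
      by (intro add_mono mult_le_mono) auto
    then have N: "N \<le> (2 * Z + 1) * 2 ^ w" by (simp add: N_def algebra_simps)
    have R: "R \<le> 2 * max 1 r" by (simp add: R_def)
    have "R \<le> N * N * R" using pos(2) by simp
    moreover have "200 * r + 20 + 20 * Suc r + 60 \<le> 320 * R" by (simp add: R_def)
    ultimately have "200 * r + 20 + N * N * R * t_iterate Z + 20 * Suc r + 60
        \<le> N * N * R * t_iterate Z + 320 * (N * N * R)" by linarith
    also have "\<dots> = N * N * R * (t_iterate Z + 320)" by (simp add: algebra_simps)
    also have "\<dots> \<le> ((2 * Z + 1) * 2 ^ w) * ((2 * Z + 1) * 2 ^ w) * (2 * max 1 r) * (t_iterate Z + 320)"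
      using N R by (intro mult_le_mono) auto
    also have "\<dots> = (2 ^ w * 2 ^ w) * max 1 r * t_main Z"
      by (simp only: t_main_def ac_simps)
    also have "(2 ^ w * 2 ^ w :: nat) = 2 ^ (2 * w)" by (simp add: mult_2 power_add)
    finally show ?thesis .
  qed
  have "prog_computes 0 [x] (enc_rankings out) (2 ^ (2 * w) * max 1 r * t_main Z)"
    using facts s(1) bound
    by (intro computesI) (auto simp: main_body_def x enc_instance_def R_def out_def)
  then show ?thesis using sol by (auto simp: w_def Z_def)
qed

text \<open>The witness for \<open>c\<close> is 2, from the square of the number of states. For
  \<open>r = 0\<close> the layers are still computed with cut-off 1, which \<open>max 1 r\<close>
  accounts for.\<close>

theorem theorem5:
  "\<exists>(P :: program) (p :: nat poly) (c :: nat).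
     \<forall>(C :: nat set) (\<P> :: nat list multiset) (r :: nat) (cs :: nat list) (\<pi>s :: nat list list).
       finite C \<and> (\<forall>\<pi>\<in>#\<P>. \<pi> \<in> permutations_of_set C) \<and>
       distinct cs \<and> set cs = C \<and> mset \<pi>s = \<P> \<longrightarrow>
       (\<exists>out t.
          run P (enc_instance cs \<pi>s r) (enc_rankings out) t \<and>
          distinct_opt_kemeny_solution C \<P> r out \<and>
          t \<le> 2 ^ (c * unanimity_width C \<P>) * max 1 r
               * poly p (input_size (enc_instance cs \<pi>s r)))"
proof -
  obtain p where p: "\<And>x. poly p x = t_main x"
    using polynomial_fun_t_main unfolding polynomial_fun_def by blast
  have "\<exists>out t. run kemeny_prog (enc_instance cs \<pi>s r) (enc_rankings out) t \<and>
          distinct_opt_kemeny_solution C \<P> r out \<and>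
          t \<le> 2 ^ (2 * unanimity_width C \<P>) * max 1 r * poly p (input_size (enc_instance cs \<pi>s r))"
    if inst: "finite C \<and> (\<forall>\<pi>\<in>#\<P>. \<pi> \<in> permutations_of_set C) \<and>
      distinct cs \<and> set cs = C \<and> mset \<pi>s = \<P>"
    for C :: "nat set" and \<P> :: "nat list multiset" and r :: nat and cs and \<pi>s
  proof -
    have "profile cs \<pi>s" using inst by unfold_locales (auto simp: permutations_of_set_def)
    from compute_main[OF this refl] obtain out where
      c: "prog_computes 0 [enc_instance cs \<pi>s r] (enc_rankings out)
            (2 ^ (2 * unanimity_width (set cs) (mset \<pi>s)) * max 1 r
              * t_main (input_size (enc_instance cs \<pi>s r)))"
      and sol: "distinct_opt_kemeny_solution (set cs) (mset \<pi>s) r out" by blast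
    have "run kemeny_prog (enc_instance cs \<pi>s r) (enc_rankings out)
        (time kemeny_prog 0 [enc_instance cs \<pi>s r])"
      using halts_eval[OF computesD(1)[OF c]] computesD(2)[OF c]
      by (simp add: run_def kemeny_prog_def)
    then show ?thesis using sol computesD(3)[OF c] inst unfolding p by blast
  qed
  then show ?thesis by blast
qed

end
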